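(* There exists an absolute constant $C>0$ such that the following holds. Let $m\ge 1$ be an integer and let $X$ be a random vector valued in $\mathbb{R}^m$ which satisfies $\|X\|_2\le 1$ almost surely. Then for every integer $k\ge 3$ there exists a partition of $\mathbb{R}^m$ into at most $k$ (Borel measurable) sets such that, for the $\sigma$-algebra $\mathcal{F}$ generated by this partition, the conditional expectation $Y=\mathbb{E}[X\mid\mathcal{F}]$ satisfies $\|\Sigma_X-\Sigma_Y\|_{\mathrm F}\le C/\sqrt{\log k}$ and, for all integers $d\ge 2$, \[\|\mathbb{E}X^{\otimes d}-\mathbb{E}Y^{\otimes d}\|_{\mathrm F}\le 4^d\cdot\frac{C}{\sqrt{\log k}}.\]
   Context: For a vector $V\in\mathbb{R}^m$, the tensor $V^{\otimes d}\in\mathbb{R}^{m\times\dots\times m}$ ($d$ factors) is defined by $V^{\otimes d}(i_1,\dots,i_d)=V(i_1)\cdots V(i_d)$ for $i_1,\dots,i_d\in\{1,\dots,m\}$. For a tensor $A\in\mathbb{R}^{m\times\dots\times m}$, $\|A\|_{\mathrm F}=\sqrt{\sum_{i_1,\dots,i_d}A(i_1,\dots,i_d)^2}$ (for $d=2$ this is the Frobenius norm of a matrix). $\Sigma_V=\mathbb{E}[(V-\mathbb{E}V)(V-\mathbb{E}V)^T]$ is the covariance matrix of a random vector $V$; $\|\cdot\|_2$ is the Euclidean norm and $\log$ the natural logarithm. $X$ is identified with its law on $\mathbb{R}^m$. For a partition $\mathbb{R}^m=A_1\sqcup\dots\sqcup A_r$ generating $\mathcal{F}$, $\mathbb{E}[X\mid\mathcal{F}]$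 is the random vector equal to $\mathbb{E}[X\mid X\in A_i]$ on the event $\{X\in A_i\}$ (for those $i$ with $\mathbb{P}[X\in A_i]>0$). The constant $C$ does not depend on $m$, $k$, $d$, or $X$. *)

theory Defs
  imports "HOL-Probability.Probability"
begin

text \<open>
  The dimension \<open>m\<close> is quantified inside the statement, below the constant \<open>C\<close>, so \<open>\<real>\<^sup>m\<close> cannot be
  \<open>real ^ 'n\<close>. It is the space of functions in \<open>{1..m} \<rightarrow>\<^sub>E UNIV\<close>; its product \<open>\<sigma>\<close>-algebra is
  the Borel \<open>\<sigma>\<close>-algebra of \<open>\<real>\<^sup>m\<close>. The Euclidean norm of \<open>x\<close> is \<open>L2_set x {1..m}\<close>.
\<close>

definition euclid :: "nat \<Rightarrow> (nat \<Rightarrow> real) measure" where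
  "euclid m = (\<Pi>\<^sub>M i\<in>{1..m}. borel)"

definition tensor_power :: "nat \<Rightarrow> (nat \<Rightarrow> real) \<Rightarrow> (nat \<Rightarrow> nat) \<Rightarrow> real" where
  "tensor_power d v = (\<lambda>\<iota>. \<Prod>j=1..d. v (\<iota> j))"

definition tensor_norm :: "nat \<Rightarrow> nat \<Rightarrow> ((nat \<Rightarrow> nat) \<Rightarrow> real) \<Rightarrow> real" where
  "tensor_norm m d A = L2_set A ({1..d} \<rightarrow>\<^sub>E {1..m})"

definition matrix_norm :: "nat \<Rightarrow> (nat \<Rightarrow> nat \<Rightarrow> real) \<Rightarrow> real" where
  "matrix_norm m A = L2_set (\<lambda>(i, j). A i j) ({1..m} \<times> {1..m})"

definition covariance_matrix :: "'a measure \<Rightarrow> ('a \<Rightarrow> nat \<Rightarrow> real) \<Rightarrow> nat \<Rightarrow> nat \<Rightarrow> real" where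
  "covariance_matrix M V i j =
     (\<integral>\<omega>. (V \<omega> i - (\<integral>\<xi>. V \<xi> i \<partial>M)) * (V \<omega> j - (\<integral>\<xi>. V \<xi> j \<partial>M)) \<partial>M)"

definition moment_tensor :: "'a measure \<Rightarrow> nat \<Rightarrow> ('a \<Rightarrow> nat \<Rightarrow> real) \<Rightarrow> (nat \<Rightarrow> nat) \<Rightarrow> real" where
  "moment_tensor M d V = (\<lambda>\<iota>. \<integral>\<omega>. tensor_power d (V \<omega>) \<iota> \<partial>M)"

definition vec_cond_exp ::
  "nat \<Rightarrow> 'a measure \<Rightarrow> 'a measure \<Rightarrow> ('a \<Rightarrow> nat \<Rightarrow> real) \<Rightarrow> 'a \<Rightarrow> nat \<Rightarrow> real" where
  "vec_cond_exp m M F V = (\<lambda>\<omega>. \<lambda>i\<in>{1..m}. real_cond_exp M F (\<lambda>\<xi>. V \<xi> i) \<omega>)"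

text \<open>
  For the \<open>\<sigma>\<close>-algebra generated by a partition into measurable sets, the library's conditional
  expectation is the conditional mean on every cell of positive probability.
\<close>

lemma sigma_sets_partition_cell:
  assumes "B \<in> sigma_sets \<Omega> P" "partition_on \<Omega> P" "A \<in> P"
  shows "A \<subseteq> B \<or> A \<inter> B = {}"
  using assms(1)
proof induction
  case (Basic B)
  then show ?case
    using assms(2,3) by (auto simp: partition_on_def disjoint_def)
next
  case Empty
  then show ?case by simp
next
  case (Compl B)
  have "A \<subseteq> \<Omega>" using assms(2,3) by (auto simp: partition_on_def)
  then show ?case using Compl by blast
next
  case (Union B)
  then show ?case by blast
qed

lemma real_cond_exp_partition:
  assumes "prob_space M" and P: "partition_on (space M) P" "P \<subseteq> sets M"
    and f: "integrable M f" and A: "A \<in> P" "measure M A > 0" and x: "x \<in> A"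
  shows "real_cond_exp M (sigma (space M) P) f x = (\<integral>y\<in>A. f y \<partial>M) / measure M A"
proof -
  interpret prob_space M by fact
  let ?F = "sigma (space M) P"
  let ?g = "real_cond_exp M ?F f"
  have Psp: "P \<subseteq> Pow (space M)" using P(2) sets.sets_into_space by blast
  have sF: "space ?F = space M" "sets ?F = sigma_sets (space M) P"
    using Psp by (simp_all add: space_measure_of sets_measure_of)
  have sub: "subalgebra M ?F"
    unfolding subalgebra_def sF using P(2) by (simp add: sets.sigma_sets_subset)
  interpret finite_measure_subalgebra M ?F
    using sub by unfold_locales
  have AF: "A \<in> sets ?F" using A by (simp add: sF)
  have AM: "A \<in> sets M" using A P by blast
  have "?g -` {?g x} \<inter> space ?F \<in> sets ?F"
    by (rule measurable_sets[OF borel_measurable_cond_exp]) simp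
  then have "A \<subseteq> ?g -` {?g x} \<inter> space M \<or> A \<inter> (?g -` {?g x} \<inter> space M) = {}"
    using sigma_sets_partition_cell[OF _ P(1) A(1)] sF by metis
  then have const: "?g y = ?g x" if "y \<in> A" for y
    using that x AM sets.sets_into_space by blast
  have "(\<integral>y\<in>A. f y \<partial>M) = (\<integral>y\<in>A. ?g y \<partial>M)"
    by (rule real_cond_exp_intA[OF f AF])
  also have "\<dots> = (\<integral>y\<in>A. ?g x \<partial>M)"
    using const by (intro set_lebesgue_integral_cong AM) auto
  also have "\<dots> = ?g x * measure M A"
    using AM by (simp add: set_lebesgue_integral_def)
  finally show ?thesis using A(2) by simp
qed

end

theory Submission
  imports Defs
begin

text \<open>
  Let \<open>S = E X X\<^sup>T\<close>, a positive semidefinite matrix of trace at most \<open>1\<close>. Its part beyond the \<open>n\<close> leading eigenvectors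
  has operator norm at most \<open>1 / n\<close>. Let \<open>w l\<close> be these eigenvectors scaled by the roots of their eigenvalues; they
  satisfy \<open>\<Sum>\<bar>\<langle>w l, x\<rangle>\<bar> \<le> 1\<close> on the unit ball. Rounding \<open>n * \<langle>w l, x\<rangle>\<close> down to integers therefore produces integer
  vectors of \<open>l\<^sub>1\<close> norm at most \<open>2 * n\<close>, of which there are at most \<open>12 ^ n\<close>, and two points with the same rounding
  have a difference \<open>z\<close> with \<open>\<langle>S z, z\<rangle> \<le> 5 / n\<close>. So \<open>k\<close> cells achieve \<open>\<langle>S z, z\<rangle> = O(1 / ln k)\<close>.

  The law of total covariance says that the lost covariance is \<open>R = E (X - Y) (X - Y)\<^sup>T\<close>. By orthogonality of
  \<open>X - Y\<close> to \<open>F\<close>-measurable functions, the squared norm of \<open>R\<close> is at most \<open>E \<langle>R X, X\<rangle>\<close>, which is the trace product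
  of \<open>S\<close> and \<open>R\<close> and hence is at most the cell diameter just found. For the higher tensors, the squared norm is
  \<open>E (g X - g Y)\<close> with \<open>g z = E (\<langle>z, X\<rangle> ^ d - \<langle>z, Y\<rangle> ^ d)\<close>; orthogonality kills the first-order Taylor term, so
  \<open>\<bar>g z\<bar> \<le> d\<^sup>2 * \<langle>R z, z\<rangle>\<close>.
\<close>

section \<open>Quadratic forms and low-rank approximation\<close>

definition ip :: "'i set \<Rightarrow> ('i \<Rightarrow> real) \<Rightarrow> ('i \<Rightarrow> real) \<Rightarrow> real" where
  "ip I x y = (\<Sum>i\<in>I. x i * y i)"

definition bilin :: "'i set \<Rightarrow> ('i \<Rightarrow> 'i \<Rightarrow> real) \<Rightarrow> ('i \<Rightarrow> real) \<Rightarrow> ('i \<Rightarrow> real) \<Rightarrow> real" where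
  "bilin I S x y = (\<Sum>i\<in>I. \<Sum>j\<in>I. S i j * x i * y j)"

lemma ip_commute: "ip I x y = ip I y x"
  by (simp add: ip_def mult.commute)

lemma ip_scale_left: "ip I (\<lambda>i. c * x i) z = c * ip I x z"
  by (simp add: ip_def algebra_simps sum_distrib_left)

lemma ip_scale_right: "ip I z (\<lambda>i. c * x i) = c * ip I z x"
  by (simp add: ip_def algebra_simps sum_distrib_left)

lemma ip_diff_left: "ip I (\<lambda>i. x i - y i) z = ip I x z - ip I y z"
  by (simp add: ip_def algebra_simps sum_subtractf)

lemma ip_diff_right: "ip I z (\<lambda>i. x i - y i) = ip I z x - ip I z y"
  by (simp add: ip_def algebra_simps sum_subtractf)

lemma ip_sum_left: "ip I (\<lambda>i. \<Sum>l\<in>L. f l i) z = (\<Sum>l\<in>L. ip I (f l) z)"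
  unfolding ip_def by (subst sum.swap) (simp add: sum_distrib_right)

lemma ip_sum_right: "ip I z (\<lambda>i. \<Sum>l\<in>L. f l i) = (\<Sum>l\<in>L. ip I z (f l))"
  using ip_sum_left[of I f L z] by (simp add: ip_commute)

lemma ip_self_nonneg [simp]: "0 \<le> ip I x x"
  by (simp add: ip_def sum_nonneg)

lemma ip_self_eq_L2_set: "ip I x x = (L2_set x I)\<^sup>2"
  by (simp add: ip_def L2_set_def sum_nonneg power2_eq_square)

lemma ip_Cauchy_Schwarz: "\<bar>ip I x y\<bar> \<le> L2_set x I * L2_set y I"
proof -
  have "\<bar>ip I x y\<bar> \<le> (\<Sum>i\<in>I. \<bar>x i\<bar> * \<bar>y i\<bar>)"
    unfolding ip_def by (rule order_trans[OF sum_abs]) (simp add: abs_mult)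
  then show ?thesis using L2_set_mult_ineq[of x y I] by linarith
qed

lemma bilin_scale_left: "bilin I S (\<lambda>i. c * x i) y = c * bilin I S x y"
  by (simp add: bilin_def sum_distrib_left algebra_simps)

lemma bilin_scale_right: "bilin I S y (\<lambda>i. c * x i) = c * bilin I S y x"
  by (simp add: bilin_def sum_distrib_left algebra_simps)

lemma bilin_add_left: "bilin I S (\<lambda>i. x i + y i) z = bilin I S x z + bilin I S y z"
  by (simp add: bilin_def sum.distrib algebra_simps)

lemma bilin_add_right: "bilin I S z (\<lambda>i. x i + y i) = bilin I S z x + bilin I S z y"
  by (simp add: bilin_def sum.distrib algebra_simps)

lemma bilin_diff_matrix: "bilin I (\<lambda>i j. S i j - T i j) x y = bilin I S x y - bilin I T x y"
  by (simp add: bilin_def sum_subtractf algebra_simps)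

lemma bilin_rank_one: "bilin I (\<lambda>i j. w i * w j) x y = ip I w x * ip I w y"
  by (simp add: bilin_def ip_def sum_product algebra_simps)

lemma bilin_scalar_matrix:
  assumes "finite I"
  shows "bilin I (\<lambda>i j. if i = j then c else 0) x y = c * ip I x y"
  unfolding bilin_def ip_def sum_distrib_left
proof (rule sum.cong[OF refl])
  fix i assume "i \<in> I"
  have "(\<Sum>j\<in>I. (if i = j then c else 0) * x i * y j) = (\<Sum>j\<in>I. if i = j then c * (x i * y j) else 0)"
    by (intro sum.cong) auto
  then show "(\<Sum>j\<in>I. (if i = j then c else 0) * x i * y j) = c * (x i * y i)"
    using \<open>i \<in> I\<close> assms by simp
qed

lemma bilin_sym:
  assumes "\<And>i j. S i j = S j i"
  shows "bilin I S x y = bilin I S y x"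
proof -
  have "bilin I S x y = (\<Sum>j\<in>I. \<Sum>i\<in>I. S j i * y j * x i)"
    unfolding bilin_def by (subst sum.swap) (intro sum.cong refl, simp add: assms[of _ _] mult_ac)
  then show ?thesis by (simp add: bilin_def)
qed

lemma bilin_unit_vector:
  assumes "finite I" "k \<in> I"
  shows "bilin I S (\<lambda>i. if i = k then 1 else 0) (\<lambda>i. if i = k then 1 else 0) = S k k"
proof -
  have "bilin I S (\<lambda>i. if i = k then 1 else 0) (\<lambda>i. if i = k then 1 else 0)
      = (\<Sum>i\<in>I. if i = k then (\<Sum>j\<in>I. if j = k then S i j else 0) else 0)"
    unfolding bilin_def by (intro sum.cong refl) (auto intro!: sum.cong)
  then show ?thesis using assms by simp
qed

text \<open>Nonnegativity of the form along the line \<open>x + t * y\<close>, taken at the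
  minimizing \<open>t\<close>. The form is only semidefinite, so the quadratic coefficient may
  vanish; then the linear one has to vanish as well.\<close>

lemma bilin_Cauchy_Schwarz:
  assumes sym: "\<And>i j. S i j = S j i" and psd: "\<And>x. 0 \<le> bilin I S x x"
  shows "(bilin I S x y)\<^sup>2 \<le> bilin I S x x * bilin I S y y"
proof -
  let ?a = "bilin I S x x" and ?b = "bilin I S x y" and ?c = "bilin I S y y"
  have quad: "0 \<le> ?a + 2 * t * ?b + t\<^sup>2 * ?c" for t
  proof -
    have "0 \<le> bilin I S (\<lambda>i. x i + t * y i) (\<lambda>i. x i + t * y i)" by (rule psd)
    also have "\<dots> = ?a + 2 * t * ?b + t\<^sup>2 * ?c"
      by (simp add: bilin_add_left bilin_add_right bilin_scale_left bilin_scale_right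
          bilin_sym[of S I y x, OF sym] power2_eq_square algebra_simps)
    finally show ?thesis .
  qed
  show ?thesis
  proof (cases "?c = 0")
    case True
    have "?b = 0"
    proof (rule ccontr)
      assume "?b \<noteq> 0"
      \<comment> \<open>At this \<open>t\<close> the affine function \<open>?a + 2 * t * ?b\<close>
        takes the value \<open>-1\<close>.\<close>
      then show False using quad[of "- (?a + 1) / (2 * ?b)"] True psd[of x] by (simp add: field_simps)
    qed
    then show ?thesis using True by simp
  next
    case False
    then have c: "?c > 0" using psd[of y] by linarith
    have "0 \<le> ?a - ?b\<^sup>2 / ?c"
      using quad[of "- ?b / ?c"] c by (simp add: power2_eq_square field_simps)
    then show ?thesis using c by (simp add: field_simps)
  qed
qed

section \<open>Leading eigenvectors by maximization on the unit ball\<close>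

text \<open>Compactness gives a maximizer, and homogeneity of degree two carries its bound from the
  ball to all vectors.\<close>

lemma bilin_max_on_ball:
  assumes "finite I"
  obtains u where "ip I u u \<le> 1" "\<And>x. bilin I S x x \<le> bilin I S u u * ip I x x"
proof -
  \<comment> \<open>Only coordinates in \<open>I\<close> enter the form. Fixing the others at 0
    places the ball inside the product \<open>K\<close> of compact sets, which is compact by
    Tychonoff's theorem for any index type.\<close>
  define B where "B = {x :: 'a \<Rightarrow> real. ip I x x \<le> 1 \<and> (\<forall>i. i \<notin> I \<longrightarrow> x i = 0)}"
  define K where "K = PiE UNIV (\<lambda>i. if i \<in> I then {-1..1::real} else {0})"
  have cont: "continuous_on UNIV (\<lambda>x :: 'a \<Rightarrow> real. ip I x x)"
    "continuous_on UNIV (\<lambda>x :: 'a \<Rightarrow> real. bilin I S x x)"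
    unfolding ip_def bilin_def by (intro continuous_intros continuous_on_product_coordinates)+
  have "compactin (product_topology (\<lambda>i::'a. euclidean :: real topology) UNIV) K"
    unfolding K_def compactin_PiE by auto
  then have "compact K" unfolding euclidean_product_topology compactin_euclidean_iff .
  moreover have "closed {x :: 'a \<Rightarrow> real. ip I x x \<le> 1}"
    using cont(1) by (intro closed_Collect_le continuous_on_const) auto
  moreover have "B = {x. ip I x x \<le> 1} \<inter> K"
  proof -
    have "\<bar>x i\<bar> \<le> 1" if "ip I x x \<le> 1" "i \<in> I" for x :: "'a \<Rightarrow> real" and i
    proof -
      have "(x i)\<^sup>2 \<le> ip I x x"
        unfolding ip_def power2_eq_square using that assms
        by (intro member_le_sum) auto
      then have "(x i)\<^sup>2 \<le> 1" using that by linarith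
      then show ?thesis by (simp add: abs_square_le_1)
    qed
    then show ?thesis by (auto simp: B_def K_def PiE_iff abs_le_iff split: if_split_asm)
  qed
  ultimately have "compact B" using closed_Int_compact by metis
  moreover have "(\<lambda>_. 0) \<in> B" by (simp add: B_def ip_def)
  ultimately obtain u where u: "u \<in> B" "\<And>y. y \<in> B \<Longrightarrow> bilin I S y y \<le> bilin I S u u"
    using continuous_attains_sup[of B "\<lambda>x. bilin I S x x"] continuous_on_subset[OF cont(2)]
    by blast
  have nonneg: "0 \<le> bilin I S u u" using u(2)[OF \<open>(\<lambda>_. 0) \<in> B\<close>] by (simp add: bilin_def)
  have "bilin I S x x \<le> bilin I S u u * ip I x x" for x
  proof (cases "ip I x x = 0")
    case True
    then have "\<forall>i\<in>I. x i = 0"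
      using assms by (simp add: ip_def sum_nonneg_eq_0_iff)
    then show ?thesis by (simp add: True bilin_def)
  next
    case False
    then have pos: "ip I x x > 0" using ip_self_nonneg[of I x] by linarith
    define c where "c = 1 / sqrt (ip I x x)"
    define y where "y = (\<lambda>i. if i \<in> I then c * x i else 0)"
    have c2: "c * c = 1 / ip I x x" using pos by (simp add: c_def)
    have "ip I y y = c * c * ip I x x"
      by (simp add: y_def ip_def sum_distrib_left algebra_simps)
    then have "y \<in> B" using c2 pos by (simp add: B_def y_def)
    moreover have "bilin I S y y = c * c * bilin I S x x"
      by (simp add: y_def bilin_def sum_distrib_left algebra_simps)
    ultimately have "c * c * bilin I S x x \<le> bilin I S u u" using u(2)[of y] by simp
    then show ?thesis unfolding c2 using pos by (simp add: field_simps)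
  qed
  then show ?thesis using that u(1) by (auto simp: B_def)
qed

text \<open>The vectors \<open>w l\<close> are the leading eigenvectors, scaled by the roots of their eigenvalues;
  each one is obtained by maximizing the quadratic form that remains on the unit ball.\<close>
lemma psd_deflation:
  fixes S :: "'i \<Rightarrow> 'i \<Rightarrow> real" and n :: nat
  assumes fin: "finite I" and sym: "\<And>i j. S i j = S j i" and psd: "\<And>x. 0 \<le> bilin I S x x"
  shows "\<exists>w. let R = (\<lambda>i j. S i j - (\<Sum>l<n. w l i * w l j)) in
     (\<forall>x. 0 \<le> bilin I R x x) \<and> (\<forall>l<n. \<forall>x. bilin I R (w l) x = 0) \<and>
     (\<forall>l<n. \<forall>x. bilin I R x x \<le> ip I (w l) (w l) * ip I x x) \<and>
     (\<forall>l<n. \<forall>l'<n. l \<noteq> l' \<longrightarrow> ip I (w l) (w l') = 0)"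
proof (induction n)
  case 0
  show ?case using psd by simp
next
  case (Suc n)
  then obtain w where w: "let R = (\<lambda>i j. S i j - (\<Sum>l<n. w l i * w l j)) in
     (\<forall>x. 0 \<le> bilin I R x x) \<and> (\<forall>l<n. \<forall>x. bilin I R (w l) x = 0) \<and>
     (\<forall>l<n. \<forall>x. bilin I R x x \<le> ip I (w l) (w l) * ip I x x) \<and>
     (\<forall>l<n. \<forall>l'<n. l \<noteq> l' \<longrightarrow> ip I (w l) (w l') = 0)" by blast
  define R where "R = (\<lambda>i j. S i j - (\<Sum>l<n. w l i * w l j))"
  have R_psd: "0 \<le> bilin I R x x" 
    and R_ker: "l < n \<Longrightarrow> bilin I R (w l) x = 0"
    and R_le: "l < n \<Longrightarrow> bilin I R x x \<le> ip I (w l) (w l) * ip I x x"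
    and orth: "l < n \<Longrightarrow> l' < n \<Longrightarrow> l \<noteq> l' \<Longrightarrow> ip I (w l) (w l') = 0" for x l l'
    using w by (auto simp: R_def Let_def)
  have R_sym: "R i j = R j i" for i j by (simp add: R_def sym[of i j] mult.commute)
  obtain u where u: "ip I u u \<le> 1" "\<And>x. bilin I R x x \<le> bilin I R u u * ip I x x"
    using bilin_max_on_ball[OF fin] by metis
  define lam where "lam = bilin I R u u"
  define v where "v = (\<lambda>i. sqrt lam * u i)"
  have lam: "lam \<ge> 0" using R_psd by (simp add: lam_def)
  \<comment> \<open>A positive maximum is attained only on the unit sphere, since rescaling an
    interior point would increase it.\<close>
  have v_norm: "ip I v v = lam"
  proof (cases "lam = 0")
    case False
    then have "ip I u u \<ge> 1" using u(2)[of u] lam by (simp add: lam_def)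
    then have "ip I u u = 1" using u(1) by simp
    then show ?thesis using lam by (simp add: v_def ip_scale_left ip_scale_right flip: mult.assoc)
  qed (simp add: v_def ip_def)
  \<comment> \<open>Maximality of \<open>u\<close> makes the matrix \<open>T\<close> of
    \<open>lam - R\<close> positive semidefinite, with value at most 0 at \<open>u\<close>.
    Cauchy-Schwarz for \<open>T\<close> then puts \<open>u\<close> into its kernel, so
    \<open>u\<close> is an eigenvector of \<open>R\<close>.\<close>
  have eig: "bilin I R u x = lam * ip I u x" for x
  proof -
    define T where "T = (\<lambda>i j. (if i = j then lam else 0) - R i j)"
    have T: "bilin I T x y = lam * ip I x y - bilin I R x y" for x y
      by (simp add: T_def bilin_diff_matrix bilin_scalar_matrix[OF fin])
    have "bilin I T u u \<le> 0" using u(1) lam by (simp add: T flip: lam_def) (simp add: mult_left_le)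
    moreover have "0 \<le> bilin I T x x" for x using u(2)[of x] by (simp add: T lam_def)
    moreover have "T i j = T j i" for i j by (simp add: T_def R_sym[of i j])
    ultimately have "(bilin I T u x)\<^sup>2 \<le> 0"
      using bilin_Cauchy_Schwarz[of T I u x] by (smt (verit) mult_nonneg_nonneg mult_eq_0_iff)
    then show ?thesis by (simp add: T)
  qed
  have v_eig: "bilin I R v x = lam * ip I v x" for x
    by (simp add: v_def bilin_scale_left ip_scale_left eig)
  \<comment> \<open>Eigenvectors of the symmetric \<open>R\<close> for different eigenvalues:
    \<open>w l\<close> lies in the kernel, and \<open>v\<close> belongs to \<open>lam\<close>. If
    \<open>lam = 0\<close>, then \<open>v\<close> itself is zero.\<close>
  have v_orth: "ip I v (w l) = 0" if "l < n" for l
  proof (cases "lam = 0")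
    case False
    have "lam * ip I v (w l) = bilin I R (w l) v"
      by (simp add: bilin_sym[of R I "w l", OF R_sym] v_eig)
    then show ?thesis using R_ker[OF that] False by simp
  qed (simp add: v_def ip_def)
  define w' where "w' = w(n := v)"
  have R'_eq: "(\<lambda>i j. S i j - (\<Sum>l<Suc n. w' l i * w' l j)) = (\<lambda>i j. R i j - v i * v j)"
    by (simp add: w'_def R_def fun_eq_iff)
  have bil': "bilin I (\<lambda>i j. R i j - v i * v j) x y = bilin I R x y - ip I v x * ip I v y" for x y
    by (simp add: bilin_diff_matrix bilin_rank_one)
  \<comment> \<open>Cauchy-Schwarz for \<open>R\<close> between \<open>v\<close> and
    \<open>x\<close>, where the eigenvector equation and \<open>ip I v v = lam\<close> give both
    sides the common factor \<open>lam * lam\<close>.\<close>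
  have psd': "0 \<le> bilin I R x x - ip I v x * ip I v x" for x
  proof (cases "lam = 0")
    case True
    then show ?thesis using R_psd[of x] by (simp add: v_def ip_def)
  next
    case False
    have "(lam * ip I v x)\<^sup>2 \<le> (lam * lam) * bilin I R x x"
      using bilin_Cauchy_Schwarz[of R I v x, OF R_sym R_psd] by (simp add: v_eig v_norm)
    then have "(lam * lam) * (ip I v x * ip I v x) \<le> (lam * lam) * bilin I R x x"
      by (simp add: power2_eq_square algebra_simps)
    then show ?thesis using False by (auto simp: mult_le_cancel_left zero_less_mult_iff linorder_neq_iff)
  qed
  have ker': "bilin I R (w' l) x - ip I v (w' l) * ip I v x = 0" if "l < Suc n" for l x
    using that by (auto simp: w'_def less_Suc_eq R_ker v_orth v_eig v_norm)
  \<comment> \<open>Subtracting a rank-one square only lowers the form, so the earlier bounds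
    persist; the new one is the maximality of \<open>u\<close>.\<close>
  have le': "bilin I R x x - ip I v x * ip I v x \<le> ip I (w' l) (w' l) * ip I x x" if "l < Suc n" for l x
  proof (cases "l = n")
    case True
    then have "ip I (w' l) (w' l) * ip I x x = lam * ip I x x" by (simp add: w'_def v_norm)
    moreover have "0 \<le> ip I v x * ip I v x" by simp
    ultimately show ?thesis using u(2)[of x] unfolding lam_def by linarith
  next
    case False
    then have "bilin I R x x \<le> ip I (w' l) (w' l) * ip I x x"
      using R_le[of l x] that by (simp add: w'_def)
    moreover have "0 \<le> ip I v x * ip I v x" by simp
    ultimately show ?thesis by linarith
  qed
  have orth': "ip I (w' l) (w' l') = 0" if "l < Suc n" "l' < Suc n" "l \<noteq> l'" for l l'
    using that v_orth ip_commute[of I v] by (auto simp: w'_def less_Suc_eq orth)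
  show ?case
    unfolding Let_def
    by (rule exI[of _ w'], unfold R'_eq bil') (use psd' ker' le' orth' in blast)
qed

text \<open>The remainder \<open>R\<close> is bounded by each of the \<open>n\<close> removed
  eigenvalues \<open>ip I (w l) (w l)\<close>, and these sum to at most the trace of
  \<open>S\<close> because \<open>R\<close> has nonnegative trace. Adding the \<open>n\<close>
  bounds gives operator norm at most \<open>1 / n\<close>; the conclusion is multiplied by
  \<open>n\<close> so that \<open>n = 0\<close> is covered.\<close>

lemma psd_low_rank_approximation:
  fixes S :: "'i \<Rightarrow> 'i \<Rightarrow> real"
  assumes fin: "finite I" and sym: "\<And>i j. S i j = S j i" and psd: "\<And>x. 0 \<le> bilin I S x x"
    and tr: "(\<Sum>i\<in>I. S i i) \<le> 1"
  obtains w :: "nat \<Rightarrow> 'i \<Rightarrow> real" where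
    "\<And>x. ip I x x \<le> 1 \<Longrightarrow> (\<Sum>l<n. \<bar>ip I (w l) x\<bar>) \<le> 1"
    "\<And>x. real n * bilin I S x x \<le> real n * (\<Sum>l<n. (ip I (w l) x)\<^sup>2) + ip I x x"
proof -
  obtain w where w: "let R = (\<lambda>i j. S i j - (\<Sum>l<n. w l i * w l j)) in
     (\<forall>x. 0 \<le> bilin I R x x) \<and> (\<forall>l<n. \<forall>x. bilin I R (w l) x = 0) \<and>
     (\<forall>l<n. \<forall>x. bilin I R x x \<le> ip I (w l) (w l) * ip I x x) \<and>
     (\<forall>l<n. \<forall>l'<n. l \<noteq> l' \<longrightarrow> ip I (w l) (w l') = 0)"
    using psd_deflation[OF fin sym psd] by blast
  define R where "R = (\<lambda>i j. S i j - (\<Sum>l<n. w l i * w l j))"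
  have R_psd: "0 \<le> bilin I R x x" 
    and R_le: "l < n \<Longrightarrow> bilin I R x x \<le> ip I (w l) (w l) * ip I x x"
    and orth: "l < n \<Longrightarrow> l' < n \<Longrightarrow> l \<noteq> l' \<Longrightarrow> ip I (w l) (w l') = 0" for x l l'
    using w by (auto simp: R_def Let_def)
  have "0 \<le> (\<Sum>i\<in>I. R i i)"
    using R_psd by (intro sum_nonneg) (metis bilin_unit_vector fin)
  also have "(\<Sum>i\<in>I. R i i) = (\<Sum>i\<in>I. S i i) - (\<Sum>l<n. ip I (w l) (w l))"
    by (simp add: R_def sum_subtractf ip_def) (rule sum.swap)
  finally have sum_le: "(\<Sum>l<n. ip I (w l) (w l)) \<le> 1" using tr by simp
  have S_eq: "bilin I S x x = bilin I R x x + (\<Sum>l<n. (ip I (w l) x)\<^sup>2)" for x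
  proof -
    have "bilin I (\<lambda>i j. \<Sum>l<n. w l i * w l j) x x = (\<Sum>i\<in>I. \<Sum>j\<in>I. \<Sum>l<n. w l i * w l j * x i * x j)"
      by (simp add: bilin_def sum_distrib_right)
    also have "\<dots> = (\<Sum>i\<in>I. \<Sum>l<n. \<Sum>j\<in>I. w l i * w l j * x i * x j)"
      by (intro sum.cong refl) (rule sum.swap)
    also have "\<dots> = (\<Sum>l<n. bilin I (\<lambda>i j. w l i * w l j) x x)"
      unfolding bilin_def by (rule sum.swap)
    finally show ?thesis
      by (simp add: R_def bilin_diff_matrix bilin_rank_one power2_eq_square)
  qed
  have "real n * bilin I R x x \<le> ip I x x" for x
  proof -
    have "real n * bilin I R x x = (\<Sum>l<n. bilin I R x x)" by simp
    also have "\<dots> \<le> (\<Sum>l<n. ip I (w l) (w l) * ip I x x)" by (intro sum_mono R_le) simp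
    also have "\<dots> = (\<Sum>l<n. ip I (w l) (w l)) * ip I x x" by (simp add: sum_distrib_right)
    also have "\<dots> \<le> ip I x x" using sum_le by (simp add: mult_left_le_one_le sum_nonneg)
    finally show ?thesis .
  qed
  then have 2: "real n * bilin I S x x \<le> real n * (\<Sum>l<n. (ip I (w l) x)\<^sup>2) + ip I x x" for x
    by (simp add: S_eq algebra_simps)
  have 1: "(\<Sum>l<n. \<bar>ip I (w l) x\<bar>) \<le> 1" if "ip I x x \<le> 1" for x
  proof -
    \<comment> \<open>Duality: the sum of absolute values is the inner product of \<open>x\<close>
      with the signed sum \<open>W\<close>. By orthogonality the squared norm of \<open>W\<close> is
      at most the sum of the eigenvalues, for any choice of signs.\<close>
    define s where "s = (\<lambda>l. sgn (ip I (w l) x))"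
    define W where "W = (\<lambda>i. \<Sum>l<n. s l * w l i)"
    have "(\<Sum>l<n. \<bar>ip I (w l) x\<bar>) = ip I W x"
      unfolding W_def s_def ip_sum_left ip_scale_left by (simp add: abs_sgn mult.commute)
    also have "\<dots> \<le> L2_set W I * L2_set x I" using ip_Cauchy_Schwarz[of I W x] by simp
    also have "\<dots> \<le> 1 * 1"
    proof (rule mult_mono)
      have "ip I W W = (\<Sum>l<n. \<Sum>l'<n. s l * (s l' * ip I (w l) (w l')))"
        by (simp add: W_def ip_sum_left ip_sum_right ip_scale_left ip_scale_right sum_distrib_left)
      also have "\<dots> = (\<Sum>l<n. \<Sum>l'<n. if l' = l then s l * s l * ip I (w l) (w l) else 0)"
        by (intro sum.cong refl) (auto simp: orth)
      also have "\<dots> = (\<Sum>l<n. s l * s l * ip I (w l) (w l))" by simp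
      also have "\<dots> \<le> (\<Sum>l<n. ip I (w l) (w l))"
        by (intro sum_mono) (simp add: s_def sgn_if)
      finally have "ip I W W \<le> 1" using sum_le by simp
      then show "L2_set W I \<le> 1" by (simp add: ip_self_eq_L2_set abs_square_le_1)
      show "L2_set x I \<le> 1" using that by (simp add: ip_self_eq_L2_set abs_square_le_1)
    qed auto
    finally show ?thesis by simp
  qed
  show ?thesis using that[OF 1 2] by blast
qed

section \<open>Counting integer vectors\<close>

lemma sum_geometric_weights: "(\<Sum>z = - int K..int K. (1/2::real) ^ nat \<bar>z\<bar>) \<le> 3"
proof -
  have "(\<Sum>z = - int K..int K. (1/2::real) ^ nat \<bar>z\<bar>) = 3 - 2 * (1/2) ^ K" 
  proof (induction K)
    case (Suc K)
    have "{- int (Suc K)..int (Suc K)} = insert (int (Suc K)) (insert (- int (Suc K)) {- int K..int K})"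
      by auto
    then show ?case using Suc by (simp add: nat_add_distrib)
  qed simp
  then show ?thesis by simp
qed

text \<open>Weight each vector \<open>z\<close> by \<open>2 powr - (\<Sum>\<bar>z l\<bar>)\<close>: the weights of all vectors sum to \<open>3 ^ n\<close>,
  and each vector counted has weight at least \<open>4 powr - n\<close>.\<close>
lemma card_integer_vectors_l1:
  fixes n :: nat
  defines "Z \<equiv> {z \<in> {..<n} \<rightarrow>\<^sub>E (UNIV :: int set). (\<Sum>l<n. \<bar>z l\<bar>) \<le> 2 * int n}"
  shows "finite Z" "card Z \<le> 12 ^ n"
proof -
  \<comment> \<open>A finite box containing \<open>Z\<close>, as one coordinate is at most the whole
    sum. Over a box the sum of product weights factors into one geometric sum per
    coordinate.\<close>
  define B where "B = {..<n} \<rightarrow>\<^sub>E {- int (2 * n)..int (2 * n)}"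
  have finB: "finite B" by (auto simp: B_def intro!: finite_PiE)
  have "\<bar>z l\<bar> \<le> 2 * int n" if "z \<in> Z" "l < n" for z l
    using that member_le_sum[of l "{..<n}" "\<lambda>l. \<bar>z l\<bar>"] by (force simp: Z_def)
  then have ZB: "Z \<subseteq> B" by (fastforce simp: B_def Z_def PiE_iff)
  then show "finite Z" using finB finite_subset by blast
  have "real (card Z) * (1/2) ^ (2 * n) = (\<Sum>z\<in>Z. (1/2::real) ^ (2 * n))" by simp
  also have "\<dots> \<le> (\<Sum>z\<in>Z. \<Prod>l<n. (1/2::real) ^ nat \<bar>z l\<bar>)"
  proof (rule sum_mono)
    fix z assume "z \<in> Z"
    then have "(\<Sum>l<n. nat \<bar>z l\<bar>) \<le> 2 * n"
      by (simp add: Z_def flip: of_nat_le_iff[where ?'a = int])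
    then show "(1/2::real) ^ (2 * n) \<le> (\<Prod>l<n. (1/2::real) ^ nat \<bar>z l\<bar>)"
      by (simp add: power_decreasing flip: power_sum)
  qed
  also have "\<dots> \<le> (\<Sum>z\<in>B. \<Prod>l<n. (1/2::real) ^ nat \<bar>z l\<bar>)"
    using ZB finB by (intro sum_mono2) (auto intro: prod_nonneg)
  also have "\<dots> = (\<Prod>l<n. \<Sum>z = - int (2 * n)..int (2 * n). (1/2::real) ^ nat \<bar>z\<bar>)"
    unfolding B_def by (rule prod_sum_PiE[symmetric]) auto
  also have "\<dots> \<le> 3 ^ n"
    using power_mono[OF sum_geometric_weights[of "2 * n"], of n] by (simp add: sum_nonneg)
  finally have "real (card Z) / 4 ^ n \<le> 3 ^ n"
    unfolding power_mult by (simp add: power_divide)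
  then have "real (card Z) \<le> 3 ^ n * 4 ^ n" by (simp add: pos_divide_le_eq)
  also have "\<dots> = real (12 ^ n)" by (simp flip: power_mult_distrib)
  finally show "card Z \<le> 12 ^ n" by (simp only: of_nat_le_iff)
qed

section \<open>Essentially bounded functions\<close>

text \<open>A class closed under sums, products and powers whose members are integrable on a finite
  measure space. Integrability of any polynomial expression in the coordinates thus reduces to
  applying introduction rules.\<close>

definition essentially_bounded :: "'a measure \<Rightarrow> ('a \<Rightarrow> real) \<Rightarrow> bool" where
  "essentially_bounded M f \<longleftrightarrow> f \<in> borel_measurable M \<and> (\<exists>B. AE x in M. \<bar>f x\<bar> \<le> B)"

lemma essentially_boundedI:
  "f \<in> borel_measurable M \<Longrightarrow> (AE x in M. \<bar>f x\<bar> \<le> B) \<Longrightarrow> essentially_bounded M f"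
  by (auto simp: essentially_bounded_def)

named_theorems ess_bounded_intros

lemma essentially_bounded_const [ess_bounded_intros]: "essentially_bounded M (\<lambda>x. c)"
  by (rule essentially_boundedI[of _ _ "\<bar>c\<bar>"]) auto

lemma essentially_bounded_add [ess_bounded_intros]:
  assumes "essentially_bounded M f" "essentially_bounded M g"
  shows "essentially_bounded M (\<lambda>x. f x + g x)"
proof -
  from assms obtain A B where AB: "AE x in M. \<bar>f x\<bar> \<le> A" "AE x in M. \<bar>g x\<bar> \<le> B"
    by (auto simp: essentially_bounded_def)
  have "AE x in M. \<bar>f x + g x\<bar> \<le> A + B" using AB by eventually_elim linarith
  then show ?thesis using assms by (auto simp: essentially_bounded_def)
qed

lemma essentially_bounded_mult [ess_bounded_intros]:
  assumes "essentially_bounded M f" "essentially_bounded M g"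
  shows "essentially_bounded M (\<lambda>x. f x * g x)"
proof -
  from assms obtain A B where AB: "AE x in M. \<bar>f x\<bar> \<le> A" "AE x in M. \<bar>g x\<bar> \<le> B"
    by (auto simp: essentially_bounded_def)
  have "AE x in M. \<bar>f x * g x\<bar> \<le> A * B"
    using AB by eventually_elim (simp add: abs_mult mult_mono')
  then show ?thesis using assms by (auto simp: essentially_bounded_def)
qed

lemma essentially_bounded_diff [ess_bounded_intros]:
  assumes "essentially_bounded M f" "essentially_bounded M g"
  shows "essentially_bounded M (\<lambda>x. f x - g x)"
  using essentially_bounded_add[OF assms(1) essentially_bounded_mult[OF essentially_bounded_const[of M "-1"] assms(2)]]
  by simp

lemma essentially_bounded_sum [ess_bounded_intros]:
  assumes "\<And>i. i \<in> J \<Longrightarrow> essentially_bounded M (f i)"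
  shows "essentially_bounded M (\<lambda>x. \<Sum>i\<in>J. f i x)"
  using assms
  by (induction J rule: infinite_finite_induct) (auto intro: ess_bounded_intros)

lemma essentially_bounded_prod [ess_bounded_intros]:
  assumes "\<And>i. i \<in> J \<Longrightarrow> essentially_bounded M (f i)"
  shows "essentially_bounded M (\<lambda>x. \<Prod>i\<in>J. f i x)"
  using assms
  by (induction J rule: infinite_finite_induct) (auto intro: ess_bounded_intros)

lemma essentially_bounded_power [ess_bounded_intros]:
  assumes "essentially_bounded M f"
  shows "essentially_bounded M (\<lambda>x. f x ^ n)"
  by (induction n) (auto intro: ess_bounded_intros assms)

lemma essentially_bounded_ip [ess_bounded_intros]:
  assumes "\<And>i. i \<in> I \<Longrightarrow> essentially_bounded M (\<lambda>x. f x i)"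
    "\<And>i. i \<in> I \<Longrightarrow> essentially_bounded M (\<lambda>x. g x i)"
  shows "essentially_bounded M (\<lambda>x. ip I (f x) (g x))"
  unfolding ip_def by (intro ess_bounded_intros assms)

lemma essentially_bounded_bilin [ess_bounded_intros]:
  assumes "\<And>i. i \<in> I \<Longrightarrow> essentially_bounded M (\<lambda>x. f x i)"
    "\<And>i. i \<in> I \<Longrightarrow> essentially_bounded M (\<lambda>x. g x i)"
  shows "essentially_bounded M (\<lambda>x. bilin I S (f x) (g x))"
  unfolding bilin_def by (intro ess_bounded_intros assms)

lemma (in finite_measure) essentially_bounded_integrable:
  assumes "essentially_bounded M f"
  shows "integrable M f"
proof -
  from assms obtain B where "f \<in> borel_measurable M" "AE x in M. \<bar>f x\<bar> \<le> B"
    by (auto simp: essentially_bounded_def)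
  then show ?thesis by (intro integrable_const_bound[where B = B]) auto
qed

lemma (in finite_measure) integral_bilin:
  assumes "\<And>i. i \<in> I \<Longrightarrow> essentially_bounded M (\<lambda>x. f x i)"
    "\<And>i. i \<in> I \<Longrightarrow> essentially_bounded M (\<lambda>x. g x i)"
  shows "(\<integral>x. bilin I T (f x) (g x) \<partial>M) = (\<Sum>i\<in>I. \<Sum>j\<in>I. T i j * (\<integral>x. f x i * g x j \<partial>M))"
proof -
  have "(\<integral>x. bilin I T (f x) (g x) \<partial>M) = (\<integral>x. (\<Sum>i\<in>I. \<Sum>j\<in>I. T i j * (f x i * g x j)) \<partial>M)"
    by (simp add: bilin_def mult.assoc)
  also have "\<dots> = (\<Sum>i\<in>I. \<Sum>j\<in>I. (\<integral>x. T i j * (f x i * g x j) \<partial>M))"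
    by (subst Bochner_Integration.integral_sum, (intro essentially_bounded_integrable ess_bounded_intros assms; assumption)+)
       (intro sum.cong refl Bochner_Integration.integral_sum essentially_bounded_integrable ess_bounded_intros assms)
  finally show ?thesis by simp
qed

text \<open>The square of \<open>ip I z (f x)\<close> is the quadratic form of the rank-one matrix
  \<open>z i * z j\<close> at \<open>f x\<close>, which can be integrated entrywise. Every matrix of
  second moments is therefore positive semidefinite.\<close>

lemma (in finite_measure) bilin_second_moment:
  assumes "\<And>i. i \<in> I \<Longrightarrow> essentially_bounded M (\<lambda>x. f x i)"
  shows "bilin I (\<lambda>i j. \<integral>x. f x i * f x j \<partial>M) z z = (\<integral>x. (ip I z (f x))\<^sup>2 \<partial>M)"
proof -
  have "(\<integral>x. (ip I z (f x))\<^sup>2 \<partial>M) = (\<integral>x. bilin I (\<lambda>i j. z i * z j) (f x) (f x) \<partial>M)"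
    by (simp add: bilin_rank_one power2_eq_square)
  also have "\<dots> = bilin I (\<lambda>i j. \<integral>x. f x i * f x j \<partial>M) z z"
    by (subst integral_bilin[OF assms assms]) (auto simp: bilin_def mult_ac)
  finally show ?thesis by simp
qed

section \<open>Conditioning a bounded random vector\<close>

text \<open>The remainders satisfy a recursion: the next one is \<open>a\<close> times the present
  one plus \<open>d * b ^ (d - 1) * (a - b)^2\<close>. The crude factor \<open>d^2\<close> closes
  the induction because \<open>d^2 + d \<le> (d + 1)^2\<close>.\<close>

lemma power_Taylor_remainder:
  fixes a b :: real
  assumes "\<bar>a\<bar> \<le> 1" "\<bar>b\<bar> \<le> 1"
  shows "\<bar>a ^ d - b ^ d - real d * b ^ (d - 1) * (a - b)\<bar> \<le> (real d)\<^sup>2 * (a - b)\<^sup>2"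
proof (induction d)
  case (Suc d)
  let ?r = "a ^ d - b ^ d - real d * b ^ (d - 1) * (a - b)"
  \<comment> \<open>The exponent \<open>d - 1\<close> is truncated at \<open>d = 0\<close>; there
    the factor \<open>real d\<close> makes both sides vanish.\<close>
  have "d = 0 \<or> b ^ d = b * b ^ (d - 1)" by (cases d) auto
  then have "real d * b ^ d = real d * (b * b ^ (d - 1))" by auto
  then have "a ^ Suc d - b ^ Suc d - real (Suc d) * b ^ (Suc d - 1) * (a - b)
      = a * ?r + real d * b ^ (d - 1) * (a - b)\<^sup>2"
    by (auto simp: algebra_simps power2_eq_square)
  also have "\<bar>\<dots>\<bar> \<le> 1 * \<bar>?r\<bar> + real d * (a - b)\<^sup>2"
  proof (rule order_trans[OF abs_triangle_ineq add_mono])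
    show "\<bar>a * ?r\<bar> \<le> 1 * \<bar>?r\<bar>"
      unfolding abs_mult using assms(1) by (rule mult_right_mono) simp
    have "\<bar>b\<bar> ^ (d - 1) \<le> 1" using assms(2) by (simp add: power_le_one)
    then show "\<bar>real d * b ^ (d - 1) * (a - b)\<^sup>2\<bar> \<le> real d * (a - b)\<^sup>2"
      by (simp add: abs_mult power_abs mult_left_le mult_right_mono)
  qed
  also have "\<dots> \<le> (real d)\<^sup>2 * (a - b)\<^sup>2 + real d * (a - b)\<^sup>2" using Suc by simp
  also have "\<dots> = ((real d)\<^sup>2 + real d) * (a - b)\<^sup>2" by (simp add: distrib_right)
  also have "\<dots> \<le> (real (Suc d))\<^sup>2 * (a - b)\<^sup>2"
  proof (rule mult_right_mono)
    show "(real d)\<^sup>2 + real d \<le> (real (Suc d))\<^sup>2" by (simp add: power2_eq_square algebra_simps)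
  qed simp
  finally show ?case .
qed simp

context
  notes One_nat_def [simp del]
begin

text \<open>Expanding the product of \<open>d\<close> copies of the inner product over all index
  maps. This turns pairings of tensors into powers of scalars.\<close>

lemma sum_tensor_power_mult:
  "(\<Sum>\<iota>\<in>{1..d} \<rightarrow>\<^sub>E {1..m}. tensor_power d z \<iota> * tensor_power d w \<iota>) = ip {1..m} z w ^ d"
proof -
  have "ip {1..m} z w ^ d = (\<Prod>j\<in>{1..d}. \<Sum>i\<in>{1..m}. z i * w i)" by (simp add: ip_def)
  also have "\<dots> = (\<Sum>\<iota>\<in>{1..d} \<rightarrow>\<^sub>E {1..m}. \<Prod>j\<in>{1..d}. z (\<iota> j) * w (\<iota> j))"
    by (rule prod_sum_PiE) auto
  finally show ?thesis by (simp add: tensor_power_def prod.distrib)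
qed

end

text \<open>The loss is analysed for an arbitrary subalgebra \<open>F\<close>. A partition enters
  later only by supplying an \<open>F\<close>-measurable vector close to \<open>X\<close>.\<close>

locale bounded_vector_cond_exp = prob_space M + finite_measure_subalgebra M F
  for M F :: "'a measure" +
  fixes m :: nat and X :: "'a \<Rightarrow> nat \<Rightarrow> real"
  assumes X_measurable: "i \<in> {1..m} \<Longrightarrow> (\<lambda>\<omega>. X \<omega> i) \<in> borel_measurable M"
    and X_norm: "AE \<omega> in M. L2_set (X \<omega>) {1..m} \<le> 1"
begin

declare One_nat_def [simp del]

abbreviation "I \<equiv> {1..m}"

abbreviation "Y \<equiv> vec_cond_exp m M F X"

definition second_moment :: "nat \<Rightarrow> nat \<Rightarrow> real" where
  "second_moment i j = (\<integral>\<omega>. X \<omega> i * X \<omega> j \<partial>M)"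

definition residual_moment :: "nat \<Rightarrow> nat \<Rightarrow> real" where
  "residual_moment i j = (\<integral>\<omega>. (X \<omega> i - Y \<omega> i) * (X \<omega> j - Y \<omega> j) \<partial>M)"

lemma X_bounded [ess_bounded_intros]:
  assumes "i \<in> I"
  shows "essentially_bounded M (\<lambda>\<omega>. X \<omega> i)"
proof (rule essentially_boundedI[OF X_measurable[OF assms], of 1])
  show "AE \<omega> in M. \<bar>X \<omega> i\<bar> \<le> 1"
    using X_norm
  proof eventually_elim
    case (elim \<omega>)
    have "\<bar>X \<omega> i\<bar> \<le> L2_set (\<lambda>i. \<bar>X \<omega> i\<bar>) I"
      by (rule member_le_L2_set[OF _ assms]) simp
    also have "\<dots> = L2_set (X \<omega>) I" by (simp add: L2_set_def)
    finally show ?case using elim by linarith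
  qed
qed

lemma Y_nth: "i \<in> I \<Longrightarrow> Y \<omega> i = real_cond_exp M F (\<lambda>\<xi>. X \<xi> i) \<omega>"
  by (simp add: vec_cond_exp_def)

lemma Y_measurable: "i \<in> I \<Longrightarrow> (\<lambda>\<omega>. Y \<omega> i) \<in> borel_measurable F"
  by (simp add: Y_nth)

lemma Y_bounded [ess_bounded_intros]:
  assumes "i \<in> I"
  shows "essentially_bounded M (\<lambda>\<omega>. Y \<omega> i)"
proof -
  obtain B where B: "AE \<omega> in M. \<bar>X \<omega> i\<bar> \<le> B"
    using X_bounded[OF assms] by (auto simp: essentially_bounded_def)
  have int: "integrable M (\<lambda>\<omega>. X \<omega> i)"
    by (rule essentially_bounded_integrable[OF X_bounded[OF assms]])
  have "AE \<omega> in M. real_cond_exp M F (\<lambda>\<xi>. X \<xi> i) \<omega> \<le> B"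
    by (rule real_cond_exp_le_c[OF int]) (use B in eventually_elim, auto)
  moreover have "AE \<omega> in M. real_cond_exp M F (\<lambda>\<xi>. X \<xi> i) \<omega> \<ge> - B"
    by (rule real_cond_exp_ge_c[OF int]) (use B in eventually_elim, auto)
  ultimately have "AE \<omega> in M. \<bar>Y \<omega> i\<bar> \<le> B"
    unfolding Y_nth[OF assms] by eventually_elim auto
  then show ?thesis
    by (intro essentially_boundedI measurable_from_subalg[OF subalg Y_measurable[OF assms]])
qed

text \<open>The defining property of conditional expectation, tested against \<open>g\<close>. All
  cross terms and first-order terms below vanish through it.\<close>

lemma residual_orthogonal:
  assumes i: "i \<in> I" and g: "g \<in> borel_measurable F" "essentially_bounded M g"
  shows "(\<integral>\<omega>. (X \<omega> i - Y \<omega> i) * g \<omega> \<partial>M) = 0"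
proof -
  have "integrable M (\<lambda>\<omega>. g \<omega> * X \<omega> i)"
    by (intro essentially_bounded_integrable ess_bounded_intros i g)
  then have "(\<integral>\<omega>. g \<omega> * Y \<omega> i \<partial>M) = (\<integral>\<omega>. g \<omega> * X \<omega> i \<partial>M)"
    unfolding Y_nth[OF i] by (rule real_cond_exp_intg(2)[OF _ g(1) X_measurable[OF i]])
  moreover have "(\<integral>\<omega>. (X \<omega> i - Y \<omega> i) * g \<omega> \<partial>M) = (\<integral>\<omega>. g \<omega> * X \<omega> i \<partial>M) - (\<integral>\<omega>. g \<omega> * Y \<omega> i \<partial>M)"
    unfolding left_diff_distrib
    by (subst Bochner_Integration.integral_diff)
       (auto intro!: essentially_bounded_integrable ess_bounded_intros i g simp: mult.commute)
  ultimately show ?thesis by simp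
qed

lemma residual_ip_orthogonal:
  assumes "\<And>i. i \<in> I \<Longrightarrow> (\<lambda>\<omega>. g \<omega> i) \<in> borel_measurable F"
    "\<And>i. i \<in> I \<Longrightarrow> essentially_bounded M (\<lambda>\<omega>. g \<omega> i)"
  shows "(\<integral>\<omega>. ip I (\<lambda>i. X \<omega> i - Y \<omega> i) (g \<omega>) \<partial>M) = 0"
  unfolding ip_def
  by (subst Bochner_Integration.integral_sum)
     (auto intro!: essentially_bounded_integrable ess_bounded_intros assms residual_orthogonal sum.neutral)

text \<open>On the \<open>F\<close>-measurable set where \<open>\<bar>Y\<bar> > 1\<close>, the integrand \<open>\<langle>X - Y, Y\<rangle>\<close> is negative, but its integral over
  that set vanishes.\<close>
lemma Y_norm: "AE \<omega> in M. L2_set (Y \<omega>) I \<le> 1"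
proof -
  define A where "A = {\<omega>\<in>space F. ip I (Y \<omega>) (Y \<omega>) > 1}"
  define h where "h = (\<lambda>\<omega>. indicator A \<omega> * ip I (\<lambda>i. X \<omega> i - Y \<omega> i) (Y \<omega>))"
  have "(\<lambda>\<omega>. ip I (Y \<omega>) (Y \<omega>)) \<in> borel_measurable F"
    unfolding ip_def by (intro borel_measurable_sum borel_measurable_times Y_measurable)
  then have A: "A \<in> sets F" unfolding A_def by measurable
  have AM: "A \<in> sets M" using A subalg by (auto simp: subalgebra_def)
  have ind_F: "indicator A \<in> borel_measurable F" using A by simp
  have ind: "essentially_bounded M (\<lambda>\<omega>. indicator A \<omega> :: real)"
    using AM by (intro essentially_boundedI[of _ _ 1]) (auto simp: indicator_def)
  have h_eq: "h \<omega> = ip I (\<lambda>i. X \<omega> i - Y \<omega> i) (\<lambda>i. indicator A \<omega> * Y \<omega> i)" for \<omega>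
    by (simp add: h_def ip_scale_right)
  have int0: "(\<integral>\<omega>. h \<omega> \<partial>M) = 0"
    unfolding h_eq
    by (intro residual_ip_orthogonal borel_measurable_times ind_F Y_measurable ess_bounded_intros ind)
  have h_int: "integrable M h"
    unfolding h_def by (intro essentially_bounded_integrable ess_bounded_intros ind)
  \<comment> \<open>The second conjunct records strict negativity on \<open>A\<close>, where
    \<open>ip I (X \<omega>) (Y \<omega>)\<close> is at most the norm of \<open>Y \<omega>\<close>
    and hence below its square. Once \<open>h\<close> is known to vanish almost everywhere, it shows
    that \<open>A\<close> is null.\<close>
  have neg: "AE \<omega> in M. h \<omega> \<le> 0 \<and> (h \<omega> = 0 \<longrightarrow> \<omega> \<notin> A)"
    using X_norm
  proof eventually_elim
    case (elim \<omega>)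
    show ?case
    proof (cases "\<omega> \<in> A")
      case True
      then have Y1: "L2_set (Y \<omega>) I > 1"
        by (simp add: A_def ip_self_eq_L2_set) (metis L2_set_nonneg linorder_not_le power_le_one)
      have "ip I (X \<omega>) (Y \<omega>) \<le> 1 * L2_set (Y \<omega>) I"
        using ip_Cauchy_Schwarz[of I "X \<omega>" "Y \<omega>"] mult_right_mono[OF elim, of "L2_set (Y \<omega>) I"] by simp
      also have "\<dots> < L2_set (Y \<omega>) I * L2_set (Y \<omega>) I"
        using Y1 by (intro mult_strict_right_mono) auto
      finally have "h \<omega> < 0"
        using True by (simp add: h_def ip_diff_left ip_self_eq_L2_set power2_eq_square)
      then show ?thesis by simp
    qed (simp add: h_def)
  qed
  have "AE \<omega> in M. - h \<omega> = 0"
    by (subst integral_nonneg_eq_0_iff_AE[symmetric]) (use h_int int0 neg in auto)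
  then show ?thesis
    using neg AE_space
  proof eventually_elim
    case (elim \<omega>)
    then have "\<omega> \<notin> A" by simp
    then have "ip I (Y \<omega>) (Y \<omega>) \<le> 1" using elim subalg by (auto simp: A_def subalgebra_def)
    then show ?case by (simp add: ip_self_eq_L2_set abs_square_le_1)
  qed
qed

section \<open>The second moment matrix and the residual matrix\<close>

lemma second_moment_sym: "second_moment i j = second_moment j i"
  by (simp add: second_moment_def mult.commute)

lemma second_moment_psd: "0 \<le> bilin I second_moment z z"
  unfolding second_moment_def by (subst bilin_second_moment) (auto intro: ess_bounded_intros)

lemma bilin_residual_moment:
  "bilin I residual_moment z z = (\<integral>\<omega>. (ip I z (X \<omega>) - ip I z (Y \<omega>))\<^sup>2 \<partial>M)"
  unfolding residual_moment_def
  by (subst bilin_second_moment) (auto intro!: ess_bounded_intros simp: ip_diff_right)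

lemma residual_moment_psd: "0 \<le> bilin I residual_moment z z"
  unfolding bilin_residual_moment by simp

lemma second_moment_trace: "(\<Sum>i\<in>I. second_moment i i) \<le> 1"
proof -
  have "(\<Sum>i\<in>I. second_moment i i) = (\<integral>\<omega>. ip I (X \<omega>) (X \<omega>) \<partial>M)"
    unfolding second_moment_def ip_def
    by (rule Bochner_Integration.integral_sum[symmetric])
       (intro essentially_bounded_integrable ess_bounded_intros)
  also have "\<dots> \<le> (\<integral>\<omega>. 1 \<partial>M)"
  proof (rule integral_mono_AE)
    show "AE \<omega> in M. ip I (X \<omega>) (X \<omega>) \<le> 1"
      using X_norm by eventually_elim (simp add: ip_self_eq_L2_set power_le_one)
  qed (auto intro!: essentially_bounded_integrable ess_bounded_intros)
  finally show ?thesis by (simp add: prob_space)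
qed

text \<open>Cauchy-Schwarz with \<open>X\<close> in the unit ball. This serves small
  \<open>k\<close>, where no eigenvector is split off and the low-rank estimate is void.\<close>

lemma second_moment_le: "bilin I second_moment z z \<le> ip I z z"
proof -
  have "bilin I second_moment z z = (\<integral>\<omega>. (ip I z (X \<omega>))\<^sup>2 \<partial>M)"
    unfolding second_moment_def by (rule bilin_second_moment) (rule ess_bounded_intros)
  also have "\<dots> \<le> (\<integral>\<omega>. ip I z z \<partial>M)"
  proof (rule integral_mono_AE)
    show "AE \<omega> in M. (ip I z (X \<omega>))\<^sup>2 \<le> ip I z z"
      using X_norm
    proof eventually_elim
      case (elim \<omega>)
      have "\<bar>ip I z (X \<omega>)\<bar> \<le> L2_set z I"
        using ip_Cauchy_Schwarz[of I z "X \<omega>"] mult_left_mono[OF elim, of "L2_set z I"] by simp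
      then show ?case by (simp add: ip_self_eq_L2_set abs_le_square_iff[symmetric])
    qed
  qed (auto intro!: essentially_bounded_integrable ess_bounded_intros)
  finally show ?thesis by (simp add: prob_space)
qed

section \<open>Loss of second moments\<close>

text \<open>Split \<open>X - v\<close> into \<open>X - Y\<close> and the \<open>F\<close>-measurable
  \<open>Y - v\<close>; the cross terms vanish by orthogonality. Taking \<open>v = 0\<close> gives
  the law of total covariance in uncentred form, and other \<open>v\<close> allow \<open>Y\<close>
  to be compared with a convenient centre.\<close>

lemma integral_shifted_product:
  assumes v: "\<And>i. i \<in> I \<Longrightarrow> (\<lambda>\<omega>. v \<omega> i) \<in> borel_measurable F"
    "\<And>i. i \<in> I \<Longrightarrow> essentially_bounded M (\<lambda>\<omega>. v \<omega> i)"
    and ij: "i \<in> I" "j \<in> I"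
  shows "(\<integral>\<omega>. (X \<omega> i - v \<omega> i) * (X \<omega> j - v \<omega> j) \<partial>M)
    = residual_moment i j + (\<integral>\<omega>. (Y \<omega> i - v \<omega> i) * (Y \<omega> j - v \<omega> j) \<partial>M)"
proof -
  have orth: "(\<integral>\<omega>. (X \<omega> i - Y \<omega> i) * (Y \<omega> j - v \<omega> j) \<partial>M) = 0" if "i \<in> I" "j \<in> I" for i j
    using that by (intro residual_orthogonal borel_measurable_diff Y_measurable ess_bounded_intros v)
  have "(\<integral>\<omega>. (X \<omega> i - v \<omega> i) * (X \<omega> j - v \<omega> j) \<partial>M) =
    (\<integral>\<omega>. (X \<omega> i - Y \<omega> i) * (X \<omega> j - Y \<omega> j) + (X \<omega> i - Y \<omega> i) * (Y \<omega> j - v \<omega> j)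
      + (X \<omega> j - Y \<omega> j) * (Y \<omega> i - v \<omega> i) + (Y \<omega> i - v \<omega> i) * (Y \<omega> j - v \<omega> j) \<partial>M)"
    by (intro Bochner_Integration.integral_cong refl) (simp add: algebra_simps)
  also have "\<dots> = residual_moment i j + (\<integral>\<omega>. (X \<omega> i - Y \<omega> i) * (Y \<omega> j - v \<omega> j) \<partial>M)
      + (\<integral>\<omega>. (X \<omega> j - Y \<omega> j) * (Y \<omega> i - v \<omega> i) \<partial>M)
      + (\<integral>\<omega>. (Y \<omega> i - v \<omega> i) * (Y \<omega> j - v \<omega> j) \<partial>M)"
    by (subst Bochner_Integration.integral_add,
        ((intro essentially_bounded_integrable ess_bounded_intros v ij)+)[2])+
       (simp add: residual_moment_def)
  finally show ?thesis using orth[OF ij] orth[OF ij(2) ij(1)] by linarith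
qed

lemma residual_moment_eq:
  assumes "i \<in> I" "j \<in> I"
  shows "residual_moment i j = second_moment i j - (\<integral>\<omega>. Y \<omega> i * Y \<omega> j \<partial>M)"
  using integral_shifted_product[of "\<lambda>_ _. 0", OF _ _ assms]
  by (simp add: second_moment_def essentially_bounded_const)

text \<open>\<open>X\<close> and \<open>Y\<close> have the same mean, so the products of means
  cancel and the uncentred identity remains.\<close>

lemma covariance_diff:
  assumes "i \<in> I" "j \<in> I"
  shows "covariance_matrix M X i j - covariance_matrix M Y i j = residual_moment i j"
proof -
  have mean: "(\<integral>\<omega>. Y \<omega> i \<partial>M) = (\<integral>\<omega>. X \<omega> i \<partial>M)" if "i \<in> I" for i
    unfolding Y_nth[OF that]
    by (intro real_cond_exp_int(2) essentially_bounded_integrable X_bounded that)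
  have cov: "covariance_matrix M Z i j = (\<integral>\<omega>. Z \<omega> i * Z \<omega> j \<partial>M) - (\<integral>\<omega>. Z \<omega> i \<partial>M) * (\<integral>\<omega>. Z \<omega> j \<partial>M)"
    if Z: "essentially_bounded M (\<lambda>\<omega>. Z \<omega> i)" "essentially_bounded M (\<lambda>\<omega>. Z \<omega> j)" for Z
  proof -
    let ?a = "\<integral>\<omega>. Z \<omega> i \<partial>M" and ?b = "\<integral>\<omega>. Z \<omega> j \<partial>M"
    have "covariance_matrix M Z i j = (\<integral>\<omega>. Z \<omega> i * Z \<omega> j - ?b * Z \<omega> i - ?a * Z \<omega> j + ?a * ?b \<partial>M)"
      unfolding covariance_matrix_def
      by (intro Bochner_Integration.integral_cong refl) (simp add: algebra_simps)
    also have "\<dots> = (\<integral>\<omega>. Z \<omega> i * Z \<omega> j \<partial>M) - (\<integral>\<omega>. ?b * Z \<omega> i \<partial>M) - (\<integral>\<omega>. ?a * Z \<omega> j \<partial>M) + (\<integral>\<omega>. ?a * ?b \<partial>M)"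
      by (subst Bochner_Integration.integral_add Bochner_Integration.integral_diff,
        ((intro essentially_bounded_integrable ess_bounded_intros Z)+)[2])+ (rule refl)
    finally show ?thesis by (simp add: prob_space)
  qed
  show ?thesis
    using assms by (simp add: cov ess_bounded_intros mean residual_moment_eq second_moment_def)
qed

lemma integral_bilin_X:
  "(\<integral>\<omega>. bilin I T (X \<omega>) (X \<omega>) \<partial>M) = (\<Sum>i\<in>I. \<Sum>j\<in>I. T i j * second_moment i j)"
  unfolding second_moment_def by (intro integral_bilin X_bounded)

lemma integral_bilin_Y:
  "(\<integral>\<omega>. bilin I T (Y \<omega>) (Y \<omega>) \<partial>M) = (\<Sum>i\<in>I. \<Sum>j\<in>I. T i j * (\<integral>\<omega>. Y \<omega> i * Y \<omega> j \<partial>M))"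
  by (intro integral_bilin Y_bounded)

text \<open>One factor of each square is replaced by the difference of the second moments of
  \<open>X\<close> and \<open>Y\<close>; the two resulting trace products are means of quadratic
  forms.\<close>

lemma residual_moment_norm:
  "(\<Sum>i\<in>I. \<Sum>j\<in>I. (residual_moment i j)\<^sup>2)
    = (\<integral>\<omega>. bilin I residual_moment (X \<omega>) (X \<omega>) \<partial>M) - (\<integral>\<omega>. bilin I residual_moment (Y \<omega>) (Y \<omega>) \<partial>M)"
proof -
  have "(\<integral>\<omega>. bilin I residual_moment (X \<omega>) (X \<omega>) \<partial>M) - (\<integral>\<omega>. bilin I residual_moment (Y \<omega>) (Y \<omega>) \<partial>M)
    = (\<Sum>i\<in>I. \<Sum>j\<in>I. residual_moment i j * (second_moment i j - (\<integral>\<omega>. Y \<omega> i * Y \<omega> j \<partial>M)))"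
    by (simp add: integral_bilin_X integral_bilin_Y right_diff_distrib sum_subtractf)
  also have "\<dots> = (\<Sum>i\<in>I. \<Sum>j\<in>I. (residual_moment i j)\<^sup>2)"
    by (intro sum.cong refl) (simp add: residual_moment_eq[symmetric] power2_eq_square)
  finally show ?thesis by simp
qed

text \<open>The difference of the two sides is a sum of squares. One bound on the mean at
  \<open>X\<close> thus controls both terms of the tensor estimate.\<close>

lemma integral_bilin_residual_moment_Y:
  "(\<integral>\<omega>. bilin I residual_moment (Y \<omega>) (Y \<omega>) \<partial>M) \<le> (\<integral>\<omega>. bilin I residual_moment (X \<omega>) (X \<omega>) \<partial>M)"
  using residual_moment_norm sum_nonneg[of I "\<lambda>i. \<Sum>j\<in>I. (residual_moment i j)\<^sup>2"]
  by (simp add: sum_nonneg)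

text \<open>The trace product of \<open>S\<close> and \<open>R\<close> is symmetric, so the left
  side is also the mean of the \<open>S\<close>-form at \<open>X - Y\<close>. Among
  \<open>F\<close>-measurable vectors \<open>Y\<close> minimizes this mean, hence any centre
  \<open>v\<close> gives an upper bound.\<close>

lemma integral_bilin_residual_moment_le:
  assumes v: "\<And>i. i \<in> I \<Longrightarrow> (\<lambda>\<omega>. v \<omega> i) \<in> borel_measurable F"
    "\<And>i. i \<in> I \<Longrightarrow> essentially_bounded M (\<lambda>\<omega>. v \<omega> i)"
    and D: "AE \<omega> in M. bilin I second_moment (\<lambda>i. X \<omega> i - v \<omega> i) (\<lambda>i. X \<omega> i - v \<omega> i) \<le> D"
  shows "(\<integral>\<omega>. bilin I residual_moment (X \<omega>) (X \<omega>) \<partial>M) \<le> D"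
proof -
  have Xv: "(\<integral>\<omega>. bilin I second_moment (\<lambda>i. X \<omega> i - v \<omega> i) (\<lambda>i. X \<omega> i - v \<omega> i) \<partial>M)
      = (\<Sum>i\<in>I. \<Sum>j\<in>I. second_moment i j * (\<integral>\<omega>. (X \<omega> i - v \<omega> i) * (X \<omega> j - v \<omega> j) \<partial>M))"
    by (intro integral_bilin ess_bounded_intros v)
  have Yv: "(\<integral>\<omega>. bilin I second_moment (\<lambda>i. Y \<omega> i - v \<omega> i) (\<lambda>i. Y \<omega> i - v \<omega> i) \<partial>M)
      = (\<Sum>i\<in>I. \<Sum>j\<in>I. second_moment i j * (\<integral>\<omega>. (Y \<omega> i - v \<omega> i) * (Y \<omega> j - v \<omega> j) \<partial>M))"
    by (intro integral_bilin ess_bounded_intros v)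
  have "(\<integral>\<omega>. bilin I residual_moment (X \<omega>) (X \<omega>) \<partial>M) = (\<Sum>i\<in>I. \<Sum>j\<in>I. second_moment i j * residual_moment i j)"
    by (simp add: integral_bilin_X mult.commute)
  also have "\<dots> = (\<integral>\<omega>. bilin I second_moment (\<lambda>i. X \<omega> i - v \<omega> i) (\<lambda>i. X \<omega> i - v \<omega> i) \<partial>M)
      - (\<integral>\<omega>. bilin I second_moment (\<lambda>i. Y \<omega> i - v \<omega> i) (\<lambda>i. Y \<omega> i - v \<omega> i) \<partial>M)"
    unfolding Xv Yv sum_subtractf[symmetric] right_diff_distrib[symmetric]
    by (intro sum.cong refl) (subst integral_shifted_product[OF v]; simp)
  also have "\<dots> \<le> (\<integral>\<omega>. bilin I second_moment (\<lambda>i. X \<omega> i - v \<omega> i) (\<lambda>i. X \<omega> i - v \<omega> i) \<partial>M)"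
    by (simp add: second_moment_psd)
  also have "\<dots> \<le> (\<integral>\<omega>. D \<partial>M)"
    by (rule integral_mono_AE[OF _ _ D]) (auto intro!: essentially_bounded_integrable ess_bounded_intros v)
  finally show ?thesis by (simp add: prob_space)
qed

lemma covariance_loss_le:
  assumes "(\<integral>\<omega>. bilin I residual_moment (X \<omega>) (X \<omega>) \<partial>M) \<le> D"
  shows "matrix_norm m (\<lambda>i j. covariance_matrix M X i j - covariance_matrix M Y i j) \<le> sqrt D"
proof -
  have "matrix_norm m (\<lambda>i j. covariance_matrix M X i j - covariance_matrix M Y i j)
      = sqrt (\<Sum>i\<in>I. \<Sum>j\<in>I. (residual_moment i j)\<^sup>2)"
    unfolding matrix_norm_def L2_set_def sum.cartesian_product
    by (intro arg_cong[of _ _ sqrt] sum.cong refl) (auto simp: covariance_diff)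
  also have "\<dots> \<le> sqrt D"
  proof (rule real_sqrt_le_mono)
    have "0 \<le> (\<integral>\<omega>. bilin I residual_moment (Y \<omega>) (Y \<omega>) \<partial>M)"
      by (intro integral_nonneg_AE) (simp add: residual_moment_psd)
    then show "(\<Sum>i\<in>I. \<Sum>j\<in>I. (residual_moment i j)\<^sup>2) \<le> D"
      unfolding residual_moment_norm using assms by linarith
  qed
  finally show ?thesis .
qed

section \<open>Loss of higher moment tensors\<close>

text \<open>Taylor expansion about \<open>ip I z (Y \<omega>)\<close>: the linear term pairs
  \<open>X - Y\<close> with the \<open>F\<close>-measurable vector \<open>g\<close> and has mean
  zero. The remainder estimate applies since \<open>Y_norm\<close> keeps both scalars in
  \<open>[-1, 1]\<close>.\<close>

lemma power_moment_diff_le: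
  assumes z: "L2_set z I \<le> 1"
  shows "\<bar>\<integral>\<omega>. ip I z (X \<omega>) ^ d - ip I z (Y \<omega>) ^ d \<partial>M\<bar> \<le> (real d)\<^sup>2 * bilin I residual_moment z z"
proof -
  define r where "r = (\<lambda>\<omega>. ip I z (X \<omega>) ^ d - ip I z (Y \<omega>) ^ d
    - real d * ip I z (Y \<omega>) ^ (d - 1) * (ip I z (X \<omega>) - ip I z (Y \<omega>)))"
  define g where "g = (\<lambda>\<omega> i. real d * ip I z (Y \<omega>) ^ (d - 1) * z i)"
  have zY: "(\<lambda>\<omega>. ip I z (Y \<omega>)) \<in> borel_measurable F"
    unfolding ip_def by (intro borel_measurable_sum borel_measurable_times borel_measurable_const Y_measurable)
  have "ip I z (X \<omega>) ^ d - ip I z (Y \<omega>) ^ d = r \<omega> + ip I (\<lambda>i. X \<omega> i - Y \<omega> i) (g \<omega>)" for \<omega>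
    unfolding r_def g_def ip_scale_right ip_diff_left ip_commute[of I _ z] by simp
  then have "(\<integral>\<omega>. ip I z (X \<omega>) ^ d - ip I z (Y \<omega>) ^ d \<partial>M)
      = (\<integral>\<omega>. r \<omega> + ip I (\<lambda>i. X \<omega> i - Y \<omega> i) (g \<omega>) \<partial>M)" by simp
  also have "\<dots> = (\<integral>\<omega>. r \<omega> \<partial>M) + (\<integral>\<omega>. ip I (\<lambda>i. X \<omega> i - Y \<omega> i) (g \<omega>) \<partial>M)"
    unfolding r_def g_def
    by (intro Bochner_Integration.integral_add essentially_bounded_integrable ess_bounded_intros)
  also have "(\<integral>\<omega>. ip I (\<lambda>i. X \<omega> i - Y \<omega> i) (g \<omega>) \<partial>M) = 0"
    unfolding g_def
    by (intro residual_ip_orthogonal borel_measurable_times borel_measurable_power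
        borel_measurable_const zY ess_bounded_intros)
  finally have "\<bar>\<integral>\<omega>. ip I z (X \<omega>) ^ d - ip I z (Y \<omega>) ^ d \<partial>M\<bar> \<le> (\<integral>\<omega>. \<bar>r \<omega>\<bar> \<partial>M)" by simp
  also have "\<dots> \<le> (\<integral>\<omega>. (real d)\<^sup>2 * (ip I z (X \<omega>) - ip I z (Y \<omega>))\<^sup>2 \<partial>M)"
  proof (rule integral_mono_AE)
    show "integrable M (\<lambda>\<omega>. \<bar>r \<omega>\<bar>)"
      unfolding r_def by (intro integrable_abs essentially_bounded_integrable ess_bounded_intros)
    show "AE \<omega> in M. \<bar>r \<omega>\<bar> \<le> (real d)\<^sup>2 * (ip I z (X \<omega>) - ip I z (Y \<omega>))\<^sup>2"
      using X_norm Y_norm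
    proof eventually_elim
      case (elim \<omega>)
      have "\<bar>ip I z w\<bar> \<le> 1" if "L2_set w I \<le> 1" for w
        using ip_Cauchy_Schwarz[of I z w] mult_le_one[OF z _ that] by simp
      then show ?case unfolding r_def using elim by (intro power_Taylor_remainder) auto
    qed
  qed (auto intro!: essentially_bounded_integrable ess_bounded_intros)
  finally show ?thesis by (simp add: bilin_residual_moment)
qed

text \<open>\<open>g z\<close> pairs the difference tensor \<open>\<Delta>\<close> with the tensor
  power of \<open>z\<close>. Its mean at \<open>X\<close> minus its mean at \<open>Y\<close> is the
  squared norm of \<open>\<Delta>\<close>, while at a fixed \<open>z\<close> in the ball it is a
  difference of scalar moments. \<open>X\<close> and \<open>Y\<close> contribute \<open>D\<close>
  each, hence \<open>2 * D\<close>.\<close>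

lemma tensor_moment_loss_le:
  assumes D: "(\<integral>\<omega>. bilin I residual_moment (X \<omega>) (X \<omega>) \<partial>M) \<le> D"
  shows "tensor_norm m d (\<lambda>\<iota>. moment_tensor M d X \<iota> - moment_tensor M d Y \<iota>) \<le> real d * sqrt (2 * D)"
proof -
  define P where "P = {1..d} \<rightarrow>\<^sub>E I"
  define \<Delta> where "\<Delta> = (\<lambda>\<iota>. moment_tensor M d X \<iota> - moment_tensor M d Y \<iota>)"
  define g where "g = (\<lambda>z. \<Sum>\<iota>\<in>P. tensor_power d z \<iota> * \<Delta> \<iota>)"
  have tpX: "essentially_bounded M (\<lambda>\<omega>. tensor_power d (X \<omega>) \<iota>)"
    and tpY: "essentially_bounded M (\<lambda>\<omega>. tensor_power d (Y \<omega>) \<iota>)" if "\<iota> \<in> P" for \<iota>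
    unfolding tensor_power_def using that
    by (auto intro!: ess_bounded_intros simp: P_def simp del: atLeastAtMost_iff)
  have gX: "essentially_bounded M (\<lambda>\<omega>. g (X \<omega>))" and gY: "essentially_bounded M (\<lambda>\<omega>. g (Y \<omega>))"
    unfolding g_def by (intro ess_bounded_intros tpX tpY; assumption)+
  have \<Delta>_eq: "\<Delta> \<iota> = (\<integral>\<omega>. tensor_power d (X \<omega>) \<iota> - tensor_power d (Y \<omega>) \<iota> \<partial>M)" if "\<iota> \<in> P" for \<iota>
    unfolding \<Delta>_def moment_tensor_def
    by (intro Bochner_Integration.integral_diff[symmetric] essentially_bounded_integrable tpX tpY that)
  have g_eq: "g z = (\<integral>\<omega>. ip I z (X \<omega>) ^ d - ip I z (Y \<omega>) ^ d \<partial>M)" for z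
  proof -
    have "g z = (\<Sum>\<iota>\<in>P. \<integral>\<omega>. tensor_power d z \<iota> * (tensor_power d (X \<omega>) \<iota> - tensor_power d (Y \<omega>) \<iota>) \<partial>M)"
      unfolding g_def by (intro sum.cong refl) (simp add: \<Delta>_eq)
    also have "\<dots> = (\<integral>\<omega>. (\<Sum>\<iota>\<in>P. tensor_power d z \<iota> * (tensor_power d (X \<omega>) \<iota> - tensor_power d (Y \<omega>) \<iota>)) \<partial>M)"
      by (intro Bochner_Integration.integral_sum[symmetric] essentially_bounded_integrable
          ess_bounded_intros tpX tpY)
    finally show ?thesis
      by (simp add: right_diff_distrib sum_subtractf P_def sum_tensor_power_mult)
  qed
  have g_le: "\<bar>g z\<bar> \<le> (real d)\<^sup>2 * bilin I residual_moment z z" if "L2_set z I \<le> 1" for z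
    unfolding g_eq by (rule power_moment_diff_le[OF that])
  have "(\<Sum>\<iota>\<in>P. (\<Delta> \<iota>)\<^sup>2) = (\<Sum>\<iota>\<in>P. \<integral>\<omega>. (tensor_power d (X \<omega>) \<iota> - tensor_power d (Y \<omega>) \<iota>) * \<Delta> \<iota> \<partial>M)"
    by (intro sum.cong refl) (simp add: \<Delta>_eq power2_eq_square)
  also have "\<dots> = (\<integral>\<omega>. (\<Sum>\<iota>\<in>P. (tensor_power d (X \<omega>) \<iota> - tensor_power d (Y \<omega>) \<iota>) * \<Delta> \<iota>) \<partial>M)"
    by (intro Bochner_Integration.integral_sum[symmetric] essentially_bounded_integrable
          ess_bounded_intros tpX tpY)
  also have "\<dots> = (\<integral>\<omega>. g (X \<omega>) - g (Y \<omega>) \<partial>M)"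
    by (simp add: g_def left_diff_distrib sum_subtractf)
  also have "\<dots> \<le> (\<integral>\<omega>. (real d)\<^sup>2 * bilin I residual_moment (X \<omega>) (X \<omega>)
      + (real d)\<^sup>2 * bilin I residual_moment (Y \<omega>) (Y \<omega>) \<partial>M)"
  proof (rule integral_mono_AE)
    show "AE \<omega> in M. g (X \<omega>) - g (Y \<omega>) \<le> (real d)\<^sup>2 * bilin I residual_moment (X \<omega>) (X \<omega>)
      + (real d)\<^sup>2 * bilin I residual_moment (Y \<omega>) (Y \<omega>)"
      using X_norm Y_norm
    proof eventually_elim
      case (elim \<omega>)
      then show ?case using g_le[of "X \<omega>"] g_le[of "Y \<omega>"] by linarith
    qed
  qed (intro essentially_bounded_integrable ess_bounded_intros gX gY)+
  also have "\<dots> = (real d)\<^sup>2 * ((\<integral>\<omega>. bilin I residual_moment (X \<omega>) (X \<omega>) \<partial>M)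
      + (\<integral>\<omega>. bilin I residual_moment (Y \<omega>) (Y \<omega>) \<partial>M))"
    by (subst Bochner_Integration.integral_add)
       (auto intro!: essentially_bounded_integrable ess_bounded_intros simp: distrib_left)
  also have "\<dots> \<le> (real d)\<^sup>2 * (2 * D)"
    using D integral_bilin_residual_moment_Y by (intro mult_left_mono) auto
  finally have "sqrt (\<Sum>\<iota>\<in>P. (\<Delta> \<iota>)\<^sup>2) \<le> sqrt ((real d)\<^sup>2 * (2 * D))" by simp
  then show ?thesis
    unfolding tensor_norm_def L2_set_def P_def[symmetric] by (simp add: \<Delta>_def real_sqrt_mult)
qed

end

section \<open>Partitions of the unit ball\<close>

text \<open>The formula for \<open>label\<close> is part of the conclusion because measurability of
  the cells is derived from it.\<close>

lemma psd_ball_labelling: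
  fixes S :: "'i \<Rightarrow> 'i \<Rightarrow> real" and k :: nat
  assumes fin: "finite I" and sym: "\<And>i j. S i j = S j i" and psd: "\<And>x. 0 \<le> bilin I S x x"
    and tr: "(\<Sum>i\<in>I. S i i) \<le> 1" and S_le: "\<And>x. bilin I S x x \<le> ip I x x" and k: "k \<ge> 2"
  obtains n :: nat and w :: "nat \<Rightarrow> 'i \<Rightarrow> real" and label where
    "label = (\<lambda>x. \<lambda>l\<in>{..<n}. \<lfloor>real n * ip I (w l) x\<rfloor>)"
    "finite (label ` {x. ip I x x \<le> 1})" "card (label ` {x. ip I x x \<le> 1}) \<le> k"
    "\<forall>x y. ip I x x \<le> 1 \<longrightarrow> ip I y y \<le> 1 \<longrightarrow> label x = label y \<longrightarrow>
      bilin I S (\<lambda>i. x i - y i) (\<lambda>i. x i - y i) \<le> 110 / ln (real k)"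
proof -
  \<comment> \<open>\<open>n\<close> is both the number of eigenvectors and the inverse mesh of the
    rounding, as large as the count \<open>12 ^ n\<close> of labels permits. For
    \<open>k < 12\<close> it is 0.\<close>
  obtain n where n: "12 ^ n \<le> k" "k < 12 ^ (n + 1)"
    using ex_power_ivl1[of 12 k] k by auto
  have "ln (real k) \<le> ln (real (12 ^ (n + 1)))"
    using n(2) k by (subst ln_le_cancel_iff) (auto simp del: of_nat_power)
  also have "\<dots> = ln ((12::real) ^ (n + 1))" by (simp only: of_nat_power of_nat_numeral)
  also have "\<dots> = real (n + 1) * ln 12" by (rule ln_realpow)
  \<comment> \<open>The crude bound \<open>ln 12 \<le> 12 - 1\<close>; the final 110 is 11 times the
    10 obtained below.\<close>
  also have "\<dots> \<le> real (n + 1) * 11"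
    using ln_le_minus_one[of 12] by (intro mult_left_mono) auto
  finally have ln_k: "ln (real k) \<le> 11 * real (n + 1)" by simp
  have ln_pos: "ln (real k) > 0" using k by simp
  obtain w :: "nat \<Rightarrow> 'i \<Rightarrow> real" where
    w1: "\<And>x. ip I x x \<le> 1 \<Longrightarrow> (\<Sum>l<n. \<bar>ip I (w l) x\<bar>) \<le> 1" and
    w2: "\<And>x. real n * bilin I S x x \<le> real n * (\<Sum>l<n. (ip I (w l) x)\<^sup>2) + ip I x x"
    using psd_low_rank_approximation[OF fin sym psd tr, of n] by blast
  define label where "label = (\<lambda>x. \<lambda>l\<in>{..<n}. \<lfloor>real n * ip I (w l) x\<rfloor>)"
  define Z where "Z = {z \<in> {..<n} \<rightarrow>\<^sub>E (UNIV :: int set). (\<Sum>l<n. \<bar>z l\<bar>) \<le> 2 * int n}"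
  have Z: "label ` {x. ip I x x \<le> 1} \<subseteq> Z"
  proof clarify
    fix x assume x: "ip I x x \<le> 1"
    have "real_of_int (\<Sum>l<n. \<bar>label x l\<bar>) = (\<Sum>l<n. \<bar>real_of_int \<lfloor>real n * ip I (w l) x\<rfloor>\<bar>)"
      by (simp add: label_def)
    \<comment> \<open>Each floor adds at most 1 in absolute value, so rounding at most doubles the
      bound \<open>n\<close> on the sum.\<close>
    also have "\<dots> \<le> (\<Sum>l<n. real n * \<bar>ip I (w l) x\<bar> + 1)"
    proof (rule sum_mono)
      fix l
      have "\<bar>real n * ip I (w l) x\<bar> = real n * \<bar>ip I (w l) x\<bar>" by (simp add: abs_mult)
      then show "\<bar>real_of_int \<lfloor>real n * ip I (w l) x\<rfloor>\<bar> \<le> real n * \<bar>ip I (w l) x\<bar> + 1" by linarith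
    qed
    also have "\<dots> = real n * (\<Sum>l<n. \<bar>ip I (w l) x\<bar>) + real n"
      by (simp add: sum.distrib sum_distrib_left)
    also have "\<dots> \<le> real n * 1 + real n" using w1[OF x] by (intro add_mono mult_left_mono) auto
    finally show "label x \<in> Z" by (simp add: Z_def label_def del: of_int_sum)
  qed
  show ?thesis
  proof (rule that[OF label_def])
    show "finite (label ` {x. ip I x x \<le> 1})"
      using Z card_integer_vectors_l1(1)[of n] unfolding Z_def by (rule finite_subset)
    show "card (label ` {x. ip I x x \<le> 1}) \<le> k"
      using card_mono[OF _ Z] card_integer_vectors_l1[of n] n(1) unfolding Z_def by linarith
    show "\<forall>x y. ip I x x \<le> 1 \<longrightarrow> ip I y y \<le> 1 \<longrightarrow> label x = label y \<longrightarrow>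
      bilin I S (\<lambda>i. x i - y i) (\<lambda>i. x i - y i) \<le> 110 / ln (real k)"
    proof (intro allI impI)
      fix x y assume x: "ip I x x \<le> 1" and y: "ip I y y \<le> 1" and eq: "label x = label y"
      let ?z = "\<lambda>i. x i - y i"
      have "L2_set x I \<le> 1" "L2_set y I \<le> 1" using x y by (auto simp: ip_self_eq_L2_set abs_square_le_1)
      then have "\<bar>ip I x y\<bar> \<le> 1"
        using ip_Cauchy_Schwarz[of I x y] mult_le_one[of "L2_set x I" "L2_set y I"] by simp
      then have z4: "ip I ?z ?z \<le> 4"
        using x y by (simp add: ip_diff_left ip_diff_right ip_commute[of I y x])
      \<comment> \<open>For \<open>n = 0\<close> the bound is 4. Otherwise \<open>n\<close> times
        the form is at most 5, namely 1 from rounding and 4 from the squared norm of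
        \<open>?z\<close>, and \<open>n + 1 \<le> 2 * n\<close> doubles it.\<close>
      have "real (n + 1) * bilin I S ?z ?z \<le> 10"
      proof (cases "n = 0")
        case True
        then show ?thesis using S_le[of ?z] z4 by simp
      next
        case False
        \<comment> \<open>Equal floors confine each of the \<open>n\<close> scaled differences to
          absolute value at most 1.\<close>
        have "(real n)\<^sup>2 * (\<Sum>l<n. (ip I (w l) ?z)\<^sup>2) \<le> (\<Sum>l<n. 1)"
          unfolding sum_distrib_left
        proof (rule sum_mono)
          fix l assume "l \<in> {..<n}"
          then have "\<lfloor>real n * ip I (w l) x\<rfloor> = \<lfloor>real n * ip I (w l) y\<rfloor>"
            using fun_cong[OF eq, of l] by (simp add: label_def)
          then have "\<bar>real n * ip I (w l) ?z\<bar> \<le> 1"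
            unfolding ip_diff_right right_diff_distrib by linarith
          then show "(real n)\<^sup>2 * (ip I (w l) ?z)\<^sup>2 \<le> 1"
            by (simp add: abs_square_le_1 flip: power_mult_distrib)
        qed
        then have "real n * (real n * (\<Sum>l<n. (ip I (w l) ?z)\<^sup>2)) \<le> real n * 1"
          by (simp add: power2_eq_square mult.assoc)
        then have "real n * (\<Sum>l<n. (ip I (w l) ?z)\<^sup>2) \<le> 1" using False by simp
        then have "real n * bilin I S ?z ?z \<le> 5" using w2[of ?z] z4 by linarith
        moreover have "real (n + 1) * bilin I S ?z ?z \<le> (2 * real n) * bilin I S ?z ?z"
          using False psd[of ?z] by (intro mult_right_mono) auto
        ultimately show ?thesis by linarith
      qed
      moreover have "ln (real k) * bilin I S ?z ?z \<le> (11 * real (n + 1)) * bilin I S ?z ?z"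
        using ln_k psd[of ?z] by (rule mult_right_mono)
      ultimately have "ln (real k) * bilin I S ?z ?z \<le> 110" by linarith
      then show "bilin I S ?z ?z \<le> 110 / ln (real k)"
        using ln_pos by (simp add: pos_le_divide_eq mult.commute)
    qed
  qed
qed

lemma partition_on_level_sets:
  "partition_on \<Omega> ((\<lambda>a. {x \<in> \<Omega>. q x = a}) ` (q ` \<Omega>))"
  by (auto simp: partition_on_def disjoint_def)

text \<open>The cells are the level sets of the labelling for \<open>S\<close>, and a representative
  of each label serves as the centre \<open>v\<close>. The single mean bounded here controls the
  covariance and the tensors of every order, so one partition serves all \<open>d\<close>.\<close>

lemma covariance_loss_partition:
  fixes m k :: nat and \<mu> :: "(nat \<Rightarrow> real) measure"
  assumes \<mu>: "prob_space \<mu>" "sets \<mu> = sets (euclid m)"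
    and norm: "AE x in \<mu>. L2_set x {1..m} \<le> 1" and k: "k \<ge> 2"
  obtains P where "partition_on (space (euclid m)) P" "P \<subseteq> sets (euclid m)" "finite P" "card P \<le> k"
    "bounded_vector_cond_exp \<mu> (sigma (space (euclid m)) P) m (\<lambda>x. x)"
    "(\<integral>x. bilin {1..m} (bounded_vector_cond_exp.residual_moment \<mu> (sigma (space (euclid m)) P) m (\<lambda>x. x)) x x \<partial>\<mu>)
      \<le> 110 / ln (real k)"
proof -
  interpret prob_space \<mu> by fact
  note [measurable_cong] = \<mu>(2)
  have sp: "space \<mu> = space (euclid m)" by (rule sets_eq_imp_space_eq[OF \<mu>(2)])
  have coord[measurable]: "(\<lambda>x. x i) \<in> borel_measurable (euclid m)" if "i \<in> {1..m}" for i
    unfolding euclid_def using that by (rule measurable_component_singleton)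
  then have coord\<mu>: "(\<lambda>x. x i) \<in> borel_measurable \<mu>" if "i \<in> {1..m}" for i
    using that by (simp add: measurable_cong_sets[OF \<mu>(2) refl] del: atLeastAtMost_iff)
  have vector_cond_exp: "bounded_vector_cond_exp \<mu> F m (\<lambda>x. x)" if "subalgebra \<mu> F" for F
    using that coord\<mu> norm by unfold_locales auto
  \<comment> \<open>The second moment matrix does not depend on the subalgebra. Taking all of
    \<open>\<mu>\<close> gives access to its properties before the partition exists.\<close>
  interpret B0: bounded_vector_cond_exp \<mu> \<mu> m "\<lambda>x. x"
    by (rule vector_cond_exp) (simp add: subalgebra_def)
  define S where "S = B0.second_moment"
  obtain n w label where
    label: "label = (\<lambda>x. \<lambda>l\<in>{..<n::nat}. \<lfloor>real n * ip {1..m} (w l) x\<rfloor>)"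
    "finite (label ` {x. ip {1..m} x x \<le> 1})" "card (label ` {x. ip {1..m} x x \<le> 1}) \<le> k"
    "\<forall>x y. ip {1..m} x x \<le> 1 \<longrightarrow> ip {1..m} y y \<le> 1 \<longrightarrow> label x = label y \<longrightarrow>
      bilin {1..m} S (\<lambda>i. x i - y i) (\<lambda>i. x i - y i) \<le> 110 / ln (real k)"
    unfolding S_def
    by (rule psd_ball_labelling[OF finite_atLeastAtMost B0.second_moment_sym B0.second_moment_psd
        B0.second_moment_trace B0.second_moment_le k], rule that[unfolded S_def])
  define U where "U = {x. ip {1..m} x x \<le> 1}"
  \<comment> \<open>Points outside the ball receive the label of 0. They form a null set, and
    merging them keeps the number of cells within \<open>k\<close>.\<close>
  define q where "q = (\<lambda>x. label (if x \<in> U then x else (\<lambda>_. 0)))"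
  define \<Omega> where "\<Omega> = space (euclid m)"
  define P where "P = (\<lambda>a. {x \<in> \<Omega>. q x = a}) ` (q ` \<Omega>)"
  have zero: "(\<lambda>_. 0) \<in> U" by (simp add: U_def ip_def)
  have q_in: "q x \<in> label ` U" for x using zero by (auto simp: q_def)
  then have q_image: "q ` \<Omega> \<subseteq> label ` U" by blast
  have fin_q: "finite (q ` \<Omega>)" using finite_subset[OF q_image] label(2) by (simp add: U_def)
  have "card P \<le> card (q ` \<Omega>)" unfolding P_def by (rule card_image_le[OF fin_q])
  also have "\<dots> \<le> k" using card_mono[OF _ q_image] label(2,3) by (auto simp: U_def)
  finally have card_P: "card P \<le> k" .
  have fin_P: "finite P" using fin_q by (simp add: P_def)
  have part: "partition_on \<Omega> P" unfolding P_def by (rule partition_on_level_sets)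
  have ip_meas[measurable]: "(\<lambda>x. ip {1..m} u x) \<in> borel_measurable (euclid m)"
    "(\<lambda>x. ip {1..m} x x) \<in> borel_measurable (euclid m)" for u
    unfolding ip_def by (intro borel_measurable_sum borel_measurable_times borel_measurable_const coord; assumption)+
  have cell: "{x \<in> \<Omega>. q x = a} \<in> sets (euclid m)" for a
  proof -
    \<comment> \<open>Labels are extensional, so equality with \<open>a\<close> amounts to finitely
      many scalar equations, each of them measurable in \<open>x\<close>.\<close>
    have label_eq: "label x = a \<longleftrightarrow> a \<in> extensional {..<n} \<and> (\<forall>l\<in>{..<n}. \<lfloor>real n * ip {1..m} (w l) x\<rfloor> = a l)" for x
      unfolding label(1) by (auto simp: fun_eq_iff extensional_def restrict_def)
    have "{x \<in> \<Omega>. q x = a} = {x \<in> space (euclid m). (ip {1..m} x x \<le> 1 \<and> a \<in> extensional {..<n} \<and>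
        (\<forall>l\<in>{..<n}. \<lfloor>real n * ip {1..m} (w l) x\<rfloor> = a l)) \<or> (\<not> ip {1..m} x x \<le> 1 \<and> label (\<lambda>_. 0) = a)}"
      by (auto simp: \<Omega>_def q_def U_def label_eq[symmetric])
    also have "\<dots> \<in> sets (euclid m)" by measurable
    finally show ?thesis .
  qed
  then have P_sets: "P \<subseteq> sets (euclid m)" by (auto simp: P_def)
  define F where "F = sigma \<Omega> P"
  have P_Pow: "P \<subseteq> Pow \<Omega>" by (auto simp: P_def)
  have F: "space F = \<Omega>" "sets F = sigma_sets \<Omega> P"
    using P_Pow by (simp_all add: F_def space_measure_of sets_measure_of)
  have "subalgebra \<mu> F"
    unfolding subalgebra_def F using P_sets \<mu>(2) sp sets.sigma_sets_subset[of P \<mu>] by (simp add: \<Omega>_def)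
  then interpret B: bounded_vector_cond_exp \<mu> F m "\<lambda>x. x" by (rule vector_cond_exp)
  \<comment> \<open>The representative depends on the label alone, so \<open>rep (q x)\<close> is
    constant on cells and hence \<open>F\<close>-measurable; lying in \<open>U\<close> makes it
    bounded.\<close>
  define rep where "rep = (\<lambda>a. SOME y. y \<in> U \<and> label y = a)"
  have rep: "rep (q x) \<in> U \<and> label (rep (q x)) = q x" for x
    unfolding rep_def using q_in[of x] by (intro someI_ex[of "\<lambda>y. y \<in> U \<and> label y = q x"]) auto
  have "(\<integral>x. bilin {1..m} B.residual_moment x x \<partial>\<mu>) \<le> 110 / ln (real k)"
  proof (rule B.integral_bilin_residual_moment_le)
    fix i assume i: "i \<in> {1..m}"
    have "q \<in> F \<rightarrow>\<^sub>M count_space (q ` \<Omega>)"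
      unfolding measurable_count_space_eq2[OF fin_q]
    proof (intro conjI ballI)
      fix a assume "a \<in> q ` \<Omega>"
      then have "{x \<in> \<Omega>. q x = a} \<in> P" by (auto simp: P_def)
      moreover have "q -` {a} \<inter> space F = {x \<in> \<Omega>. q x = a}" by (auto simp: F)
      ultimately show "q -` {a} \<inter> space F \<in> sets F" by (simp add: F)
    qed (auto simp: F)
    then show v_meas: "(\<lambda>x. rep (q x) i) \<in> borel_measurable F"
      by (rule measurable_compose) simp
    have "\<bar>rep (q x) i\<bar> \<le> 1" for x
    proof -
      have "(rep (q x) i)\<^sup>2 \<le> ip {1..m} (rep (q x)) (rep (q x))"
        unfolding ip_def power2_eq_square using i by (intro member_le_sum) auto
      also have "\<dots> \<le> 1" using rep[of x] by (simp add: U_def)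
      finally show ?thesis by (simp add: abs_square_le_1)
    qed
    then show "essentially_bounded \<mu> (\<lambda>x. rep (q x) i)"
      by (intro essentially_boundedI[of _ _ 1] measurable_from_subalg[OF B.subalg v_meas]) auto
  next
    show "AE x in \<mu>. bilin {1..m} B.second_moment (\<lambda>i. x i - rep (q x) i) (\<lambda>i. x i - rep (q x) i)
        \<le> 110 / ln (real k)"
      using norm
    proof eventually_elim
      case (elim x)
      then have x: "ip {1..m} x x \<le> 1" by (simp add: ip_self_eq_L2_set power_le_one)
      then have "label x = q x" by (simp add: q_def U_def)
      also have "q x = label (rep (q x))" using rep[of x] by simp
      finally have same: "label x = label (rep (q x))" .
      have "ip {1..m} (rep (q x)) (rep (q x)) \<le> 1" using rep[of x] by (simp add: U_def)
      then show ?case using label(4)[rule_format, OF x _ same] unfolding S_def by blast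
    qed
  qed
  note bound = this[unfolded F_def \<Omega>_def]
  show ?thesis
    by (rule that[OF part[unfolded \<Omega>_def] P_sets fin_P card_P
          B.bounded_vector_cond_exp_axioms[unfolded F_def \<Omega>_def] bound])
qed

section \<open>Choice of the constant\<close>

theorem mainTheorem2:
  shows "\<exists>C::real. C > 0 \<and>
    (\<forall>(m::nat) (\<mu> :: (nat \<Rightarrow> real) measure).
      m \<ge> 1 \<longrightarrow> prob_space \<mu> \<longrightarrow> sets \<mu> = sets (euclid m) \<longrightarrow>
      (AE x in \<mu>. L2_set x {1..m} \<le> 1) \<longrightarrow>
      (\<forall>k::nat. k \<ge> 3 \<longrightarrow>
        (\<exists>P :: (nat \<Rightarrow> real) set set.
          partition_on (space (euclid m)) P \<and> P \<subseteq> sets (euclid m) \<and> finite P \<and> card P \<le> k \<and>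
          (let X = (\<lambda>x. x); F = sigma (space (euclid m)) P; Y = vec_cond_exp m \<mu> F X in
            matrix_norm m (\<lambda>i j. covariance_matrix \<mu> X i j - covariance_matrix \<mu> Y i j)
              \<le> C / sqrt (ln (real k)) \<and>
            (\<forall>d::nat. d \<ge> 2 \<longrightarrow>
              tensor_norm m d (\<lambda>\<iota>. moment_tensor \<mu> d X \<iota> - moment_tensor \<mu> d Y \<iota>)
                \<le> 4 ^ d * (C / sqrt (ln (real k))))))))"
proof (intro exI[of _ 15] conjI allI impI)
  fix m k :: nat and \<mu> :: "(nat \<Rightarrow> real) measure"
  assume \<mu>: "prob_space \<mu>" "sets \<mu> = sets (euclid m)" "AE x in \<mu>. L2_set x {1..m} \<le> 1" and k: "k \<ge> 3"
  define D where "D = 110 / ln (real k)"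
  have "D \<ge> 0" using k by (simp add: D_def)
  then have "sqrt D \<le> sqrt (2 * D)" by simp
  \<comment> \<open>The constant 15 comes from \<open>2 * 110 = 220 \<le> 15^2\<close>.\<close>
  moreover have "sqrt (2 * D) \<le> 15 / sqrt (ln (real k))"
  proof -
    have "sqrt (2 * D) = sqrt 220 / sqrt (ln (real k))" by (simp add: D_def real_sqrt_divide)
    also have "sqrt 220 \<le> sqrt (15\<^sup>2)" by (intro real_sqrt_le_mono) simp
    then have "sqrt 220 / sqrt (ln (real k)) \<le> 15 / sqrt (ln (real k))"
      using k by (intro divide_right_mono) auto
    finally show ?thesis .
  qed
  ultimately have D: "sqrt D \<le> 15 / sqrt (ln (real k))" "sqrt (2 * D) \<le> 15 / sqrt (ln (real k))" by linarith+
  obtain P where P: "partition_on (space (euclid m)) P" "P \<subseteq> sets (euclid m)" "finite P" "card P \<le> k"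
    "bounded_vector_cond_exp \<mu> (sigma (space (euclid m)) P) m (\<lambda>x. x)"
    "(\<integral>x. bilin {1..m} (bounded_vector_cond_exp.residual_moment \<mu> (sigma (space (euclid m)) P) m (\<lambda>x. x)) x x \<partial>\<mu>) \<le> D"
    unfolding D_def using covariance_loss_partition[OF \<mu>, of k] k by auto
  interpret B: bounded_vector_cond_exp \<mu> "sigma (space (euclid m)) P" m "\<lambda>x. x" by (rule P(5))
  have "tensor_norm m d (\<lambda>\<iota>. moment_tensor \<mu> d (\<lambda>x. x) \<iota> - moment_tensor \<mu> d B.Y \<iota>)
      \<le> 4 ^ d * (15 / sqrt (ln (real k)))" for d
  proof -
    have "tensor_norm m d (\<lambda>\<iota>. moment_tensor \<mu> d (\<lambda>x. x) \<iota> - moment_tensor \<mu> d B.Y \<iota>) \<le> real d * sqrt (2 * D)"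
      by (rule B.tensor_moment_loss_le[OF P(6)])
    also have "\<dots> \<le> 4 ^ d * (15 / sqrt (ln (real k)))"
    proof (rule mult_mono[OF _ D(2)])
      \<comment> \<open>The loss grows only linearly in \<open>d\<close>, well within the allowed
        \<open>4 ^ d\<close>.\<close>
      have "real d < 2 ^ d" by (rule of_nat_less_two_power)
      also have "(2::real) ^ d \<le> 4 ^ d" by (intro power_mono) auto
      finally show "real d \<le> 4 ^ d" by simp
    qed (use k in \<open>auto simp: D_def\<close>)
    finally show ?thesis .
  qed
  then show "\<exists>P :: (nat \<Rightarrow> real) set set.
          partition_on (space (euclid m)) P \<and> P \<subseteq> sets (euclid m) \<and> finite P \<and> card P \<le> k \<and>
          (let X = (\<lambda>x. x); F = sigma (space (euclid m)) P; Y = vec_cond_exp m \<mu> F X in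
            matrix_norm m (\<lambda>i j. covariance_matrix \<mu> X i j - covariance_matrix \<mu> Y i j)
              \<le> 15 / sqrt (ln (real k)) \<and>
            (\<forall>d::nat. d \<ge> 2 \<longrightarrow>
              tensor_norm m d (\<lambda>\<iota>. moment_tensor \<mu> d X \<iota> - moment_tensor \<mu> d Y \<iota>)
                \<le> 4 ^ d * (15 / sqrt (ln (real k)))))"
    using P(1-4) order_trans[OF B.covariance_loss_le[OF P(6)] D(1)] unfolding Let_def by blast
qed simp

end
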